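(* Let $a_1,a_2,b_1,b_2,c_1,c_2>0$ be general six vertex weights, let $\eta>0$, let $\mathbb{T}=\mathbb{Z}/M\mathbb{Z}\times\mathbb{Z}/N\mathbb{Z}$, and let $k_1,k_2$ be arbitrary integers for which the set $\mathcal{S}_{k_1,k_2}$ of path configurations is nonempty. The continuous time Markov process $\mathcal{L}(\tau)$ on path configurations on the torus $\mathbb{T}$ with jump rates $$\mathfrak{c}=\eta\frac{c_1c_2}{\sqrt{b_1b_2a_1a_2}},\qquad \mathfrak{a}=\eta\frac{\sqrt{b_1b_2}}{\sqrt{a_1a_2}},\qquad \mathfrak{b}=\eta\frac{\sqrt{a_1a_2}}{\sqrt{b_1b_2}}$$ preserves the six vertex Gibbs measure $\mu_{k_1,k_2}$ with weights $a_1,a_2,b_1,b_2,c_1,c_2$.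
   Context: **Configurations on the torus.** $M\ge1$, $N\ge2$. A path configuration on $\mathbb{T}$ assigns to every edge of the $M\times N$ torus graph the state occupied ($1$) or empty ($0$), so that at every vertex $i_1+j_1=i_2+j_2$, where $i_1,j_1,i_2,j_2\in\{0,1\}$ are the states of the bottom, left, top, right adjacent edges. The vertex type is written $(i_1,j_1;i_2,j_2)$. $\mathcal{S}_{k_1,k_2}$ is the set of configurations with overall height changes $k_1$ and $k_2$ in the $x$ and $y$ directions, that is, with exactly $k_1$ occupied vertical edges between any two consecutive rows, and exactly $k_2$ occupied horizontal edges between any two consecutive columns. **Gibbs measure.** Vertex weights: $w(0,0;0,0)=a_1$, $w(1,1;1,1)=a_2$, $w(1,0;1,0)=b_1$, $w(0,1;0,1)=b_2$, $w(1,0;0,1)=c_1$, $w(0,1;1,0)=c_2$. Then $\mu_{k_1,k_2}$ is the probability measure on $\mathcal{S}_{k_1,k_2}$ proportional to the product of $w$ over all vertices. **Seed pairs.** A pair $v_1=(x,y)$, $v_2=(x,y+1)$ (coordinates modulo $M$, $N$) is a seed pair if the types (type of $v_1$ / type of $v_2$) are one of the following; its rate is indicated. Up jump: $(0,1;0,1)/(0,0;0,0)$, rate $\mathfrak{c}$; $(1,0;0,1)/(0,0;0,0)$, rate $\mathfrak{a}$; $(0,1;0,1)/(0,1;1,0)$, rate $\mathfrak{b}$. Down jump: $(1,0;1,0)/(1,1;1,1)$, rate $\mathfrak{c}$; $(0,1;1,0)/(1,1;1,1)$, rate $\mathfrak{a}$; $(1,0;1,0)/(1,0;0,1)$, rate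 $\mathfrak{b}$. **The process $\mathcal{L}(\tau)$.** Each seed pair carries an independent exponential clock with its rate; when it rings, the following jump is performed. For fixed $y$ let $L_i,U_i$ be the horizontal edges $(i,y)-(i+1,y)$ and $(i,y+1)-(i+1,y+1)$, and $V_i$ the vertical edge $(i,y)-(i,y+1)$, $i\in\mathbb{Z}/M\mathbb{Z}$. For an up jump at $x$: (1) if it is not true that $L_i$ is occupied and $U_i$ is empty for all $i\in\mathbb{Z}/M\mathbb{Z}$, let $c\ge0$ be the largest integer such that $L_{x+j}$ is occupied and $U_{x+j}$ is empty for all $j=0,\ldots,c$; make $V_x$ occupied, swap the states of $L_{x+j},U_{x+j}$ for $0\le j\le c$, and change $V_{x+c+1}$ from occupied to empty; (2) if $L_i$ is occupied and $U_i$ is empty for all $i$, the jump makes a full loop around the torus: the states of $L_i$ and $U_i$ are swapped for all $i$, and no vertical edge changes. For a down jump the same rules hold with occupied and empty interchanged. *)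

theory Defs
  imports "HOL-Probability.Probability"
begin

section \<open>Path configurations on the torus\<close>

text \<open>
  The torus has vertices \<open>(x, y)\<close> with \<open>0 \<le> x < M\<close> and \<open>0 \<le> y < N\<close>.
  \<open>Hor x y\<close> is the edge from \<open>(x, y)\<close> to \<open>(x + 1, y)\<close> and \<open>Ver x y\<close> the edge
  from \<open>(x, y)\<close> to \<open>(x, y + 1)\<close>. Edges are named by their starting point rather than by their
  two end points because for \<open>M \<le> 2\<close> or \<open>N = 2\<close> the torus graph has loops or parallel edges.
\<close>

datatype edge = Hor int int | Ver int int

definition hor :: "nat \<Rightarrow> nat \<Rightarrow> int \<Rightarrow> int \<Rightarrow> edge" where
  "hor M N x y = Hor (x mod int M) (y mod int N)"

definition ver :: "nat \<Rightarrow> nat \<Rightarrow> int \<Rightarrow> int \<Rightarrow> edge" where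
  "ver M N x y = Ver (x mod int M) (y mod int N)"

definition torus_edges :: "nat \<Rightarrow> nat \<Rightarrow> edge set" where
  "torus_edges M N =
     {e. \<exists>x\<in>{0..<int M}. \<exists>y\<in>{0..<int N}. e = Hor x y \<or> e = Ver x y}"

type_synonym config = "edge \<Rightarrow> bool"

type_synonym vtype = "nat \<times> nat \<times> nat \<times> nat"

text \<open>The tuple \<open>(i1, j1, i2, j2)\<close> of states of the bottom, left, top and right edges.\<close>

definition vertex_type :: "nat \<Rightarrow> nat \<Rightarrow> config \<Rightarrow> int \<Rightarrow> int \<Rightarrow> vtype" where
  "vertex_type M N \<sigma> x y =
     (of_bool (\<sigma> (ver M N x (y - 1))), of_bool (\<sigma> (hor M N (x - 1) y)),
      of_bool (\<sigma> (ver M N x y)), of_bool (\<sigma> (hor M N x y)))"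

text \<open>Configurations are extended by \<open>False\<close> to edge names that do not belong to the torus.\<close>

definition path_configs :: "nat \<Rightarrow> nat \<Rightarrow> config set" where
  "path_configs M N =
     {\<sigma>. (\<forall>e. e \<notin> torus_edges M N \<longrightarrow> \<not> \<sigma> e) \<and>
         (\<forall>x\<in>{0..<int M}. \<forall>y\<in>{0..<int N}.
            case vertex_type M N \<sigma> x y of (i1, j1, i2, j2) \<Rightarrow> i1 + j1 = i2 + j2)}"

definition sector :: "nat \<Rightarrow> nat \<Rightarrow> int \<Rightarrow> int \<Rightarrow> config set" where
  "sector M N k1 k2 =
     {\<sigma> \<in> path_configs M N.
        (\<forall>y\<in>{0..<int N}. int (card {x\<in>{0..<int M}. \<sigma> (ver M N x y)}) = k1) \<and>
        (\<forall>x\<in>{0..<int M}. int (card {y\<in>{0..<int N}. \<sigma> (hor M N x y)}) = k2)}"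


section \<open>The six vertex Gibbs measure\<close>

definition six_vertex_weight ::
  "real \<Rightarrow> real \<Rightarrow> real \<Rightarrow> real \<Rightarrow> real \<Rightarrow> real \<Rightarrow> vtype \<Rightarrow> real" where
  "six_vertex_weight a1 a2 b1 b2 c1 c2 t =
     (if t = (0,0,0,0) then a1
      else if t = (1,1,1,1) then a2
      else if t = (1,0,1,0) then b1
      else if t = (0,1,0,1) then b2
      else if t = (1,0,0,1) then c1
      else if t = (0,1,1,0) then c2
      else 0)"

definition config_weight :: "nat \<Rightarrow> nat \<Rightarrow> (vtype \<Rightarrow> real) \<Rightarrow> config \<Rightarrow> real" where
  "config_weight M N w \<sigma> =
     (\<Prod>x\<in>{0..<int M}. \<Prod>y\<in>{0..<int N}. w (vertex_type M N \<sigma> x y))"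

text \<open>
  The Gibbs measure lives on \<open>sector M N k1 k2\<close>; it is extended by zero to the state space
  \<open>path_configs M N\<close> of the process.
\<close>

definition gibbs_measure ::
  "nat \<Rightarrow> nat \<Rightarrow> (vtype \<Rightarrow> real) \<Rightarrow> int \<Rightarrow> int \<Rightarrow> config measure" where
  "gibbs_measure M N w k1 k2 =
     point_measure (path_configs M N)
       (\<lambda>\<sigma>. ennreal (if \<sigma> \<in> sector M N k1 k2
                     then config_weight M N w \<sigma> /
                          (\<Sum>\<sigma>'\<in>sector M N k1 k2. config_weight M N w \<sigma>')
                     else 0))"


section \<open>Seed pairs and jumps\<close>

text \<open>
  Throughout, the direction \<open>d\<close> is \<open>True\<close> for up jumps and \<open>False\<close> for down jumps.
  \<open>seed_rate C A B d t1 t2\<close> is the rate of the pair \<open>(x, y)\<close>, \<open>(x, y + 1)\<close> of vertices of types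
  \<open>t1\<close>, \<open>t2\<close>, and it is zero if this is not a seed pair for direction \<open>d\<close>.
\<close>

definition seed_rate ::
  "real \<Rightarrow> real \<Rightarrow> real \<Rightarrow> bool \<Rightarrow> vtype \<Rightarrow> vtype \<Rightarrow> real" where
  "seed_rate C A B d t1 t2 =
     (if d then
        (if t1 = (0,1,0,1) \<and> t2 = (0,0,0,0) then C
         else if t1 = (1,0,0,1) \<and> t2 = (0,0,0,0) then A
         else if t1 = (0,1,0,1) \<and> t2 = (0,1,1,0) then B
         else 0)
      else
        (if t1 = (1,0,1,0) \<and> t2 = (1,1,1,1) then C
         else if t1 = (0,1,1,0) \<and> t2 = (1,1,1,1) then A
         else if t1 = (1,0,1,0) \<and> t2 = (1,0,0,1) then B
         else 0))"

text \<open>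
  \<open>movable M N d \<sigma> y i\<close>: the lower edge of column \<open>i\<close> is occupied and the upper one is empty
  (for \<open>d = True\<close>), or the other way round (for \<open>d = False\<close>).
\<close>

definition movable :: "nat \<Rightarrow> nat \<Rightarrow> bool \<Rightarrow> config \<Rightarrow> int \<Rightarrow> int \<Rightarrow> bool" where
  "movable M N d \<sigma> y i \<longleftrightarrow> \<sigma> (hor M N i y) = d \<and> \<sigma> (hor M N i (y + 1)) = (\<not> d)"

text \<open>
  The edges whose states are swapped satisfy \<open>movable\<close>, so that swapping sets the lower one to
  \<open>\<not> d\<close> and the upper one to \<open>d\<close>.
\<close>

definition jump :: "nat \<Rightarrow> nat \<Rightarrow> bool \<Rightarrow> int \<Rightarrow> int \<Rightarrow> config \<Rightarrow> config" where
  "jump M N d x y \<sigma> =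
     (if \<forall>i\<in>{0..<int M}. movable M N d \<sigma> y i then
        (\<lambda>e. if \<exists>i\<in>{0..<int M}. e = hor M N i y then \<not> d
             else if \<exists>i\<in>{0..<int M}. e = hor M N i (y + 1) then d
             else \<sigma> e)
      else
        (let c = (GREATEST c::nat. \<forall>j\<le>c. movable M N d \<sigma> y (x + int j)) in
         (\<lambda>e. if e = ver M N x y then d
              else if e = ver M N (x + int c + 1) y then \<not> d
              else if \<exists>j\<le>c. e = hor M N (x + int j) y then \<not> d
              else if \<exists>j\<le>c. e = hor M N (x + int j) (y + 1) then d
              else \<sigma> e)))"

text \<open>
  Several seed pairs may lead to the same new configuration (for instance those of a full loop);
  as their clocks are independent, their rates add up.
\<close>

definition jump_rate ::
  "nat \<Rightarrow> nat \<Rightarrow> real \<Rightarrow> real \<Rightarrow> real \<Rightarrow> config \<Rightarrow> config \<Rightarrow> real" where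
  "jump_rate M N C A B \<sigma> \<sigma>' =
     (\<Sum>x\<in>{0..<int M}. \<Sum>y\<in>{0..<int N}. \<Sum>d\<in>UNIV.
        (if jump M N d x y \<sigma> = \<sigma>'
         then seed_rate C A B d (vertex_type M N \<sigma> x y) (vertex_type M N \<sigma> x (y + 1))
         else 0))"


section \<open>Continuous time Markov processes on a finite set\<close>

definition generator :: "'s set \<Rightarrow> ('s \<Rightarrow> 's \<Rightarrow> real) \<Rightarrow> 's \<Rightarrow> 's \<Rightarrow> real" where
  "generator S q s s' = (if s' = s then - (\<Sum>u\<in>S - {s}. q s u) else q s s')"

text \<open>
  \<open>P t s s'\<close> is the probability to be in \<open>s'\<close> a time \<open>t\<close> after being in \<open>s\<close>. The derivative at
  zero says that in a short time \<open>h\<close> a jump from \<open>s\<close> to \<open>s' \<noteq> s\<close> has probability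
  \<open>q s s' * h + o(h)\<close>.
\<close>

definition transition_function ::
  "'s set \<Rightarrow> ('s \<Rightarrow> 's \<Rightarrow> real) \<Rightarrow> (real \<Rightarrow> 's \<Rightarrow> 's \<Rightarrow> real) \<Rightarrow> bool" where
  "transition_function S q P \<longleftrightarrow>
     (\<forall>t\<ge>0. \<forall>s\<in>S. (\<forall>s'\<in>S. P t s s' \<ge> 0) \<and> (\<Sum>s'\<in>S. P t s s') = 1) \<and>
     (\<forall>s\<in>S. \<forall>s'\<in>S. P 0 s s' = of_bool (s = s')) \<and>
     (\<forall>t\<ge>0. \<forall>u\<ge>0. \<forall>s\<in>S. \<forall>s'\<in>S. P (t + u) s s' = (\<Sum>r\<in>S. P t s r * P u r s')) \<and>
     (\<forall>s\<in>S. \<forall>s'\<in>S.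
        ((\<lambda>t. P t s s') has_real_derivative generator S q s s') (at 0 within {0..}))"

text \<open>
  \<open>markov_jump_process \<Omega> S q X\<close>: the process \<open>X\<close> on the probability space \<open>\<Omega>\<close> is a
  time-homogeneous Markov process with finite state space \<open>S\<close> and jump rates \<open>q\<close>, started from
  an arbitrary distribution. The last condition is the Markov property, with the conditional
  probability given the past multiplied out.
\<close>

definition markov_jump_process ::
  "'w measure \<Rightarrow> 's set \<Rightarrow> ('s \<Rightarrow> 's \<Rightarrow> real) \<Rightarrow> (real \<Rightarrow> 'w \<Rightarrow> 's) \<Rightarrow> bool" where
  "markov_jump_process \<Omega> S q X \<longleftrightarrow>
     prob_space \<Omega> \<and>
     (\<forall>t\<ge>0. X t \<in> \<Omega> \<rightarrow>\<^sub>M count_space S) \<and>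
     (\<exists>P. transition_function S q P \<and>
        (\<forall>(n::nat) (t :: nat \<Rightarrow> real) (s :: nat \<Rightarrow> 's).
           0 \<le> t 0 \<longrightarrow> (\<forall>i\<le>n. t i \<le> t (Suc i)) \<longrightarrow> (\<forall>i\<le>Suc n. s i \<in> S) \<longrightarrow>
           measure \<Omega> {\<omega> \<in> space \<Omega>. \<forall>i\<le>Suc n. X (t i) \<omega> = s i} =
           measure \<Omega> {\<omega> \<in> space \<Omega>. \<forall>i\<le>n. X (t i) \<omega> = s i} *
             P (t (Suc n) - t n) (s n) (s (Suc n))))"

end

theory Submission
  imports Defs
begin

text \<open>
  A jump of the time reversed process starts at the right end of the swapped stretch of columns and
  runs to the left, again as far as possible. Multiplying the rate of a jump by the ratio of the
  weights before and after it gives the rate of the reversed jump: the columns inside the stretch do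
  not change the weight, the column at the seed turns each of the three rates into the same constant
  \<open>K\<close>, and the column at the other end turns \<open>K\<close> into one of \<open>C\<close>, \<open>A\<close>, \<open>B\<close>, depending only on
  the types of the two vertices there. Hence the Gibbs measure is stationary if in every
  configuration the reversed seed pairs have the same total rate as the seed pairs. The difference is
  a sum over all vertical pairs of neighbours of a local term which is a sum of differences
  telescoping along columns and along rows. It does not vanish row by row: a full loop is undone
  at a different total rate.
\<close>

section \<open>Stationary distributions of finite jump processes\<close>

text \<open>The reversed rates are the original ones rotated by 180 degrees:
  \<open>rev_seed_rate\<close> arises from \<open>seed_rate\<close> by exchanging the two vertices
  and replacing each type \<open>(i1, j1, i2, j2)\<close> by \<open>(i2, j2, i1, j1)\<close>. Full
  loops show why detailed balance cannot be used: a loop does not change the weight, but with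
  \<open>k\<close> occupied vertical edges between the two rows an up loop has total rate
  \<open>C * (M - k)\<close> and the down loop undoing it \<open>C * k\<close>. In such a row the
  reversed and the original total rates differ by \<open>C * (2 * k - M)\<close> up to sign, so only
  the sum over all rows can cancel. The telescoping terms come from separating the coefficients of
  \<open>A\<close>, \<open>B\<close>, \<open>C\<close> in the local difference. For a lower vertex
  \<open>p\<close> and an upper vertex \<open>q\<close>, let D be [left edges differ] -
  [right edges differ]. Twice the coefficient of \<open>A\<close> is [\<open>q\<close> has a c type]
  - [\<open>p\<close> has a c type] + D, and for \<open>B\<close> the two c terms change sign. Twice
  the coefficient of \<open>C\<close> compares a and b types of \<open>p\<close> and
  \<open>q\<close> and then subtracts D. As every conserving vertex has an a, b or c type, the c
  terms can be expressed by the others.\<close>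

lemma transition_function_generator_sum:
  assumes "finite S" "transition_function S q P" "r \<in> S"
    and bal: "(\<Sum>s\<in>S. p s * q s r) = p r * (\<Sum>u\<in>S. q r u)"
  shows "((\<lambda>t. \<Sum>s\<in>S. p s * P t s r) has_real_derivative 0) (at 0 within {0..})"
proof -
  have "((\<lambda>t. \<Sum>s\<in>S. p s * P t s r) has_real_derivative (\<Sum>s\<in>S. p s * generator S q s r))
          (at 0 within {0..})"
    using assms(2,3) by (intro DERIV_sum DERIV_cmult) (auto simp: transition_function_def)
  moreover have "(\<Sum>s\<in>S. p s * generator S q s r) = 0"
  proof -
    have "(\<Sum>s\<in>S. p s * generator S q s r)
        = p r * generator S q r r + (\<Sum>s\<in>S-{r}. p s * generator S q s r)"
      using assms(1,3) by (rule sum.remove)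
    also have "(\<Sum>s\<in>S-{r}. p s * generator S q s r) = (\<Sum>s\<in>S-{r}. p s * q s r)"
      by (rule sum.cong) (auto simp: generator_def)
    also have "\<dots> = (\<Sum>s\<in>S. p s * q s r) - p r * q r r"
      using sum.remove[OF assms(1,3), of "\<lambda>s. p s * q s r"] by simp
    also have "\<dots> = p r * (\<Sum>u\<in>S - {r}. q r u)"
      using sum.remove[OF assms(1,3), of "\<lambda>u. q r u"] by (simp add: bal algebra_simps)
    finally show ?thesis by (simp add: generator_def)
  qed
  ultimately show ?thesis by simp
qed

text \<open>A derivative is given only at time zero, so no differential equation is solved. By
  Chapman-Kolmogorov, one more step of length \<open>h\<close> changes the law by at most
  \<open>G h\<close>, whatever the time already elapsed, and \<open>G h\<close> is o(h) by balance.
  Cutting \<open>t\<close> into \<open>n\<close> steps bounds the total change by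
  \<open>n * G (t / n)\<close>, which tends to zero.\<close>

lemma sum_stationary_transition:
  assumes fin: "finite S" and tf: "transition_function S q P"
    and bal: "\<And>r. r \<in> S \<Longrightarrow> (\<Sum>s\<in>S. p s * q s r) = p r * (\<Sum>u\<in>S. q r u)"
    and t: "t \<ge> 0" and s': "s' \<in> S"
  shows "(\<Sum>s\<in>S. p s * P t s s') = p s'"
proof (cases "t = 0")
  case True
  then have "(\<Sum>s\<in>S. p s * P t s s') = (\<Sum>s\<in>S. p s * of_bool (s = s'))"
    using tf s' by (intro sum.cong) (auto simp: transition_function_def)
  also have "\<dots> = p s'"
    using fin s' by simp
  finally show ?thesis .
next
  case False
  with t have tpos: "t > 0" by simp
  define F where "F h r = (\<Sum>s\<in>S. p s * P h s r) - p r" for h r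
  define G where "G h = (\<Sum>r\<in>S. \<bar>F h r\<bar>)" for h
  define f where "f u = (\<Sum>s\<in>S. p s * P u s s')" for u
  have P0: "P 0 s r = of_bool (s = r)" if "s \<in> S" "r \<in> S" for s r
    using tf that by (auto simp: transition_function_def)
  have sum0: "(\<Sum>s\<in>S. p s * P 0 s r) = p r" if "r \<in> S" for r
  proof -
    have "(\<Sum>s\<in>S. p s * P 0 s r) = (\<Sum>s\<in>S. p s * of_bool (s = r))"
      using that by (intro sum.cong) (auto simp: P0)
    then show ?thesis using fin that by simp
  qed
  have P01: "\<bar>P u r s'\<bar> \<le> 1" if "u \<ge> 0" "r \<in> S" for u r
  proof -
    have nonneg: "\<And>a. a \<in> S \<Longrightarrow> P u r a \<ge> 0" and one: "(\<Sum>a\<in>S. P u r a) = 1"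
      using tf that by (auto simp: transition_function_def)
    have "P u r s' \<le> (\<Sum>a\<in>S. P u r a)"
      using s' nonneg fin by (intro member_le_sum) auto
    then show ?thesis using one nonneg[OF s'] by simp
  qed
  have step: "\<bar>f (h + u) - f u\<bar> \<le> G h" if "h \<ge> 0" "u \<ge> 0" for h u
  proof -
    have "f (h + u) = (\<Sum>s\<in>S. p s * (\<Sum>r\<in>S. P h s r * P u r s'))"
      unfolding f_def using tf that s' by (intro sum.cong) (auto simp: transition_function_def)
    also have "\<dots> = (\<Sum>r\<in>S. (\<Sum>s\<in>S. p s * P h s r) * P u r s')"
      unfolding sum_distrib_left sum_distrib_right
      by (subst sum.swap) (simp add: mult.assoc)
    finally have "f (h + u) - f u = (\<Sum>r\<in>S. F h r * P u r s')"
      by (simp add: f_def F_def sum_subtractf left_diff_distrib)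
    also have "\<bar>\<dots>\<bar> \<le> (\<Sum>r\<in>S. \<bar>F h r * P u r s'\<bar>)" by (rule sum_abs)
    also have "\<dots> \<le> G h"
      unfolding G_def
    proof (rule sum_mono)
      fix r assume "r \<in> S"
      then show "\<bar>F h r * P u r s'\<bar> \<le> \<bar>F h r\<bar>"
        using P01[OF that(2)] mult_left_mono[of "\<bar>P u r s'\<bar>" 1 "\<bar>F h r\<bar>"]
        by (simp add: abs_mult)
    qed
    finally show ?thesis .
  qed
  have steps: "\<bar>f (real n * h) - f 0\<bar> \<le> real n * G h" if "h \<ge> 0" for n h
  proof (induction n)
    case (Suc n)
    have "\<bar>f (h + real n * h) - f (real n * h)\<bar> \<le> G h"
      using that by (intro step) auto
    with Suc show ?case by (simp add: algebra_simps)
  qed simp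
  have G_lim: "((\<lambda>h. G h / h) \<longlongrightarrow> 0) (at_right 0)"
  proof -
    have "((\<lambda>h. \<Sum>r\<in>S. \<bar>F h r / h\<bar>) \<longlongrightarrow> (\<Sum>r\<in>S. 0)) (at_right 0)"
    proof (intro tendsto_sum tendsto_rabs_zero)
      fix r assume r: "r \<in> S"
      have "((\<lambda>t. \<Sum>s\<in>S. p s * P t s r) has_real_derivative 0) (at 0 within {0..})"
        using transition_function_generator_sum[OF fin tf r bal[OF r]] .
      then have "((\<lambda>h. F h r / h) \<longlongrightarrow> 0) (at 0 within {0..})"
        using sum0[OF r] by (simp add: has_field_derivative_iff F_def)
      then show "((\<lambda>h. F h r / h) \<longlongrightarrow> 0) (at_right 0)"
        by (rule tendsto_within_subset) auto
    qed
    then have "((\<lambda>h. \<Sum>r\<in>S. \<bar>F h r / h\<bar>) \<longlongrightarrow> 0) (at_right 0)" by simp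
    then show ?thesis
      by (rule Lim_transform_eventually)
        (auto simp: eventually_at_right_less G_def sum_divide_distrib abs_divide
              intro!: eventually_mono[OF eventually_at_right_less])
  qed
  have lim: "(\<lambda>n. t * (G (t / real n) / (t / real n))) \<longlonglongrightarrow> t * 0"
  proof (intro tendsto_mult tendsto_const filterlim_compose[OF G_lim])
    show "filterlim (\<lambda>n. t / real n) (at_right 0) sequentially"
      unfolding filterlim_at
      using tpos by (auto intro!: eventually_mono[OF eventually_gt_at_top[of 0]] lim_const_over_n)
  qed
  have "\<bar>f t - f 0\<bar> \<le> 0"
  proof (rule tendsto_lowerbound)
    show "(\<lambda>n. t * (G (t / real n) / (t / real n))) \<longlonglongrightarrow> 0" using lim by simp
    show "\<forall>\<^sub>F n in sequentially. \<bar>f t - f 0\<bar> \<le> t * (G (t / real n) / (t / real n))"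
    proof (rule eventually_mono[OF eventually_gt_at_top[of 0]])
      fix n :: nat assume "n > 0"
      then show "\<bar>f t - f 0\<bar> \<le> t * (G (t / real n) / (t / real n))"
        using steps[of "t / real n" n] tpos by (simp add: field_simps)
    qed
  qed simp
  then show ?thesis using sum0[OF s'] by (simp add: f_def)
qed

lemma markov_jump_process_stationary:
  assumes fin: "finite S" and mp: "markov_jump_process \<Omega> S q X"
    and dist0: "distr \<Omega> (count_space S) (X 0) = point_measure S (\<lambda>s. ennreal (p s))"
    and nonneg: "\<And>s. s \<in> S \<Longrightarrow> p s \<ge> 0"
    and bal: "\<And>r. r \<in> S \<Longrightarrow> (\<Sum>s\<in>S. p s * q s r) = p r * (\<Sum>u\<in>S. q r u)"
    and t: "t \<ge> 0"
  shows "distr \<Omega> (count_space S) (X t) = point_measure S (\<lambda>s. ennreal (p s))"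
proof -
  interpret prob_space \<Omega> using mp by (simp add: markov_jump_process_def)
  have X: "X u \<in> \<Omega> \<rightarrow>\<^sub>M count_space S" if "u \<ge> 0" for u
    using mp that by (simp add: markov_jump_process_def)
  obtain P where tf: "transition_function S q P" and
    mk: "\<And>(n::nat) (t :: nat \<Rightarrow> real) s.
           0 \<le> t 0 \<Longrightarrow> (\<forall>i\<le>n. t i \<le> t (Suc i)) \<Longrightarrow> (\<forall>i\<le>Suc n. s i \<in> S) \<Longrightarrow>
           measure \<Omega> {\<omega> \<in> space \<Omega>. \<forall>i\<le>Suc n. X (t i) \<omega> = s i} =
           measure \<Omega> {\<omega> \<in> space \<Omega>. \<forall>i\<le>n. X (t i) \<omega> = s i} *
             P (t (Suc n) - t n) (s n) (s (Suc n))"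
    using mp unfolding markov_jump_process_def by blast
  have vimage: "X u -` {s} \<inter> space \<Omega> = {\<omega> \<in> space \<Omega>. X u \<omega> = s}" for u s
    by auto
  have init: "prob {\<omega> \<in> space \<Omega>. X 0 \<omega> = s} = p s" if "s \<in> S" for s
  proof -
    have "emeasure (distr \<Omega> (count_space S) (X 0)) {s} = ennreal (p s)"
      using fin that by (simp add: dist0 emeasure_point_measure_finite)
    then have "emeasure \<Omega> {\<omega> \<in> space \<Omega>. X 0 \<omega> = s} = ennreal (p s)"
      using X[of 0] that by (simp add: emeasure_distr vimage)
    then show ?thesis using nonneg[OF that] by (simp add: measure_def)
  qed
  have two: "prob {\<omega> \<in> space \<Omega>. X 0 \<omega> = s \<and> X t \<omega> = s'} = p s * P t s s'"
    if "s \<in> S" "s' \<in> S" for s s'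
  proof -
    \<comment> \<open>The Markov property is used with \<open>n = 0\<close>, that is, for the two
      times 0 and \<open>t\<close>; both sequences are constant from index 1 on.\<close>
    have "(\<forall>i\<le>Suc 0. X (case i of 0 \<Rightarrow> 0 | Suc _ \<Rightarrow> t) \<omega> = (case i of 0 \<Rightarrow> s | Suc _ \<Rightarrow> s'))
        \<longleftrightarrow> X 0 \<omega> = s \<and> X t \<omega> = s'" for \<omega>
      by (auto simp: le_Suc_eq)
    then show ?thesis
      using mk[of "\<lambda>i. case i of 0 \<Rightarrow> 0 | Suc _ \<Rightarrow> t" 0 "\<lambda>i. case i of 0 \<Rightarrow> s | Suc _ \<Rightarrow> s'"]
        that t init[OF that(1)]
      by (simp add: le_Suc_eq)
  qed
  have marg: "prob {\<omega> \<in> space \<Omega>. X t \<omega> = s'} = p s'" if s': "s' \<in> S" for s'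
  proof -
    have ms: "{\<omega> \<in> space \<Omega>. X 0 \<omega> = s \<and> X t \<omega> = s'} \<in> sets \<Omega>" if "s \<in> S" for s
    proof -
      have "{\<omega> \<in> space \<Omega>. X 0 \<omega> = s \<and> X t \<omega> = s'} =
          (X 0 -` {s} \<inter> space \<Omega>) \<inter> (X t -` {s'} \<inter> space \<Omega>)" by auto
      also have "\<dots> \<in> sets \<Omega>"
        using that s' by (intro sets.Int measurable_sets[OF X] t) auto
      finally show ?thesis .
    qed
    have "{\<omega> \<in> space \<Omega>. X t \<omega> = s'} = (\<Union>s\<in>S. {\<omega> \<in> space \<Omega>. X 0 \<omega> = s \<and> X t \<omega> = s'})"
      using measurable_space[OF X[of 0]] by auto
    also have "prob \<dots> = (\<Sum>s\<in>S. prob {\<omega> \<in> space \<Omega>. X 0 \<omega> = s \<and> X t \<omega> = s'})"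
      using fin ms by (intro finite_measure_finite_Union) (auto simp: disjoint_family_on_def)
    also have "\<dots> = (\<Sum>s\<in>S. p s * P t s s')"
      using s' by (intro sum.cong) (auto simp: two)
    also have "\<dots> = p s'"
      by (rule sum_stationary_transition[OF fin tf bal t s'])
    finally show ?thesis .
  qed
  show ?thesis
  proof (rule measure_eqI_finite[where A = S])
    show "sets (distr \<Omega> (count_space S) (X t)) = Pow S" by simp
    show "sets (point_measure S (\<lambda>s. ennreal (p s))) = Pow S" by (simp add: sets_point_measure)
    show "finite S" by fact
    fix a assume a: "a \<in> S"
    have "emeasure (distr \<Omega> (count_space S) (X t)) {a} = emeasure \<Omega> {\<omega> \<in> space \<Omega>. X t \<omega> = a}"
      using X[OF t] a by (simp add: emeasure_distr vimage)
    also have "\<dots> = ennreal (p a)"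
      by (simp add: emeasure_eq_measure marg[OF a])
    finally show "emeasure (distr \<Omega> (count_space S) (X t)) {a} =
        emeasure (point_measure S (\<lambda>s. ennreal (p s))) {a}"
      using fin a by (simp add: emeasure_point_measure_finite)
  qed
qed

text \<open>Both sums equal the sum over the graph of \<open>R\<close>.\<close>

lemma sum_eq_via_relation:
  fixes f :: "'a \<Rightarrow> 'c::comm_semiring_1"
  assumes "finite A" "finite B"
    and AB: "\<And>a. a \<in> A \<Longrightarrow> f a \<noteq> 0 \<Longrightarrow> \<exists>!b. b \<in> B \<and> R a b"
    and BA: "\<And>b. b \<in> B \<Longrightarrow> g b \<noteq> 0 \<Longrightarrow> \<exists>!a. a \<in> A \<and> R a b"
    and eq: "\<And>a b. a \<in> A \<Longrightarrow> b \<in> B \<Longrightarrow> R a b \<Longrightarrow> f a = g b"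
  shows "sum f A = sum g B"
proof -
  have "f a = (\<Sum>b\<in>B. of_bool (R a b) * f a)" if a: "a \<in> A" for a
  proof (cases "f a = 0")
    case False
    then obtain b where b: "b \<in> B" "R a b" "\<And>b'. b' \<in> B \<Longrightarrow> R a b' \<longleftrightarrow> b' = b"
      using AB[OF a False] by blast
    have "(\<Sum>b\<in>B. of_bool (R a b) * f a) = (\<Sum>b'\<in>B. of_bool (b' = b) * f a)"
      using b(3) by (intro sum.cong) auto
    also have "\<dots> = f a"
      using b(1) \<open>finite B\<close> by (simp flip: sum_distrib_right)
    finally show ?thesis by simp
  qed simp
  then have "sum f A = (\<Sum>a\<in>A. \<Sum>b\<in>B. of_bool (R a b) * f a)" by (intro sum.cong) auto
  also have "\<dots> = (\<Sum>b\<in>B. \<Sum>a\<in>A. of_bool (R a b) * f a)" by (rule sum.swap)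
  also have "\<dots> = (\<Sum>b\<in>B. \<Sum>a\<in>A. of_bool (R a b) * g b)"
    using eq by (intro sum.cong) auto
  also have "\<dots> = sum g B"
  proof (rule sum.cong)
    fix b assume b: "b \<in> B"
    show "(\<Sum>a\<in>A. of_bool (R a b) * g b) = g b"
    proof (cases "g b = 0")
      case False
      then obtain a where a: "a \<in> A" "R a b" "\<And>a'. a' \<in> A \<Longrightarrow> R a' b \<longleftrightarrow> a' = a"
        using BA[OF b False] by blast
      have "(\<Sum>a\<in>A. of_bool (R a b) * g b) = (\<Sum>a'\<in>A. of_bool (a' = a) * g b)"
        using a(3) by (intro sum.cong) auto
      also have "\<dots> = g b"
        using a(1) \<open>finite A\<close> by (simp flip: sum_distrib_right)
      finally show ?thesis by simp
    qed simp
  qed simp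
  finally show ?thesis .
qed

section \<open>Jumps along an arc and along a full loop\<close>

text \<open>The length \<open>c\<close> is an explicit parameter instead of a
  \<open>GREATEST\<close>, so that the same map with direction \<open>\<not> d\<close> can undo a
  jump on exactly the stretch that was swapped, whether or not a forward jump would stop
  there.\<close>

definition arc_jump :: "nat \<Rightarrow> nat \<Rightarrow> bool \<Rightarrow> int \<Rightarrow> int \<Rightarrow> nat \<Rightarrow> config \<Rightarrow> config" where
  "arc_jump M N d x y c \<sigma> =
     (\<lambda>e. if e = ver M N x y then d
          else if e = ver M N (x + int c + 1) y then \<not> d
          else if \<exists>j\<le>c. e = hor M N (x + int j) y then \<not> d
          else if \<exists>j\<le>c. e = hor M N (x + int j) (y + 1) then d
          else \<sigma> e)"

definition loop_jump :: "nat \<Rightarrow> nat \<Rightarrow> bool \<Rightarrow> int \<Rightarrow> config \<Rightarrow> config" where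
  "loop_jump M N d y \<sigma> =
     (\<lambda>e. if \<exists>i\<in>{0..<int M}. e = hor M N i y then \<not> d
          else if \<exists>i\<in>{0..<int M}. e = hor M N i (y + 1) then d
          else \<sigma> e)"

lemma jump_eq_loop:
  "\<forall>i\<in>{0..<int M}. movable M N d \<sigma> y i \<Longrightarrow> jump M N d x y \<sigma> = loop_jump M N d y \<sigma>"
  by (simp add: jump_def loop_jump_def)

lemma jump_eq_arc:
  assumes "\<not> (\<forall>i\<in>{0..<int M}. movable M N d \<sigma> y i)"
    and run: "\<And>j. j \<le> c \<Longrightarrow> movable M N d \<sigma> y (x + int j)"
    and stop: "\<not> movable M N d \<sigma> y (x + int c + 1)"
  shows "jump M N d x y \<sigma> = arc_jump M N d x y c \<sigma>"
proof -
  have g: "(GREATEST c::nat. \<forall>j\<le>c. movable M N d \<sigma> y (x + int j)) = c"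
  proof (rule Greatest_equality)
    show "c' \<le> c" if "\<forall>j\<le>c'. movable M N d \<sigma> y (x + int j)" for c'
    proof (rule ccontr)
      assume "\<not> c' \<le> c"
      then have "movable M N d \<sigma> y (x + int (Suc c))"
        using spec[OF that, of "Suc c"] \<open>\<not> c' \<le> c\<close> by simp
      also have "x + int (Suc c) = x + int c + 1" by simp
      finally show False using stop by contradiction
    qed
  qed (use run in blast)
  show ?thesis
    by (simp only: jump_def if_not_P[OF assms(1)] g Let_def arc_jump_def)
qed

lemma hor_eq_iff [simp]:
  "hor M N i y = hor M N i' y' \<longleftrightarrow> i mod int M = i' mod int M \<and> y mod int N = y' mod int N"
  by (simp add: hor_def)

lemma ver_eq_iff [simp]:
  "ver M N i y = ver M N i' y' \<longleftrightarrow> i mod int M = i' mod int M \<and> y mod int N = y' mod int N"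
  by (simp add: ver_def)

lemma hor_neq_ver [simp]: "hor M N i y \<noteq> ver M N i' y'" "ver M N i' y' \<noteq> hor M N i y"
  by (simp_all add: hor_def ver_def)

lemma mod_eq_add_iff:
  fixes i x m :: int
  assumes "j < nat m"
  shows "i mod m = (x + int j) mod m \<longleftrightarrow> (i - x) mod m = int j"
proof -
  have "i mod m = (x + int j) mod m \<longleftrightarrow> (i - x) mod m = int j mod m"
    by (metis add_diff_cancel_left' diff_add_cancel add.commute mod_add_left_eq mod_diff_left_eq)
  also have "int j mod m = int j" using assms by simp
  finally show ?thesis .
qed

lemma mod_minus_one:
  fixes k m :: int
  assumes "m > 0"
  shows "(k - 1) mod m = (if k mod m = 0 then m - 1 else k mod m - 1)"
proof -
  have b: "0 \<le> k mod m" "k mod m < m" using assms by auto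
  have "(k - 1) mod m = (k mod m - 1) mod m" by (simp add: mod_diff_left_eq)
  also have "\<dots> = (if k mod m = 0 then m - 1 else k mod m - 1)"
  proof (cases "k mod m = 0")
    case True
    then show ?thesis using assms by (simp add: zmod_minus1)
  next
    case False
    then show ?thesis using b by (auto intro!: mod_pos_pos_trivial)
  qed
  finally show ?thesis .
qed

section \<open>Coordinates modulo the side lengths\<close>

locale torus =
  fixes M N :: nat
  assumes M: "M \<ge> 1" and N: "N \<ge> 2"
begin

lemma row_neq [simp]:
  "y mod int N \<noteq> (y + 1) mod int N" "(y + 1) mod int N \<noteq> y mod int N"
  "(y - 1) mod int N \<noteq> y mod int N" "y mod int N \<noteq> (y - 1) mod int N"
proof -
  have *: "y mod int N \<noteq> (y + 1) mod int N" for y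
    using N mod_eq_dvd_iff[of y "int N" "y + 1"] by auto
  show "y mod int N \<noteq> (y + 1) mod int N" "(y + 1) mod int N \<noteq> y mod int N"
    using *[of y] by auto
  show "(y - 1) mod int N \<noteq> y mod int N" "y mod int N \<noteq> (y - 1) mod int N"
    using *[of "y - 1"] by auto
qed

lemma mod_M_bounds [simp]: "0 \<le> i mod int M" "i mod int M < int M"
  using M by auto

lemma mod_N_bounds [simp]: "0 \<le> i mod int N" "i mod int N < int N"
  using N by auto

lemma hor_cong: "x mod int M = x' mod int M \<Longrightarrow> y mod int N = y' mod int N \<Longrightarrow> hor M N x y = hor M N x' y'"
  by simp

lemma ver_cong: "x mod int M = x' mod int M \<Longrightarrow> y mod int N = y' mod int N \<Longrightarrow> ver M N x y = ver M N x' y'"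
  by simp

lemma vertex_type_cong:
  assumes "x mod int M = x' mod int M" "y mod int N = y' mod int N"
  shows "vertex_type M N \<sigma> x y = vertex_type M N \<sigma> x' y'"
proof -
  have "(x - 1) mod int M = (x' - 1) mod int M" "(y - 1) mod int N = (y' - 1) mod int N"
    using assms by (metis mod_diff_left_eq)+
  then show ?thesis
    unfolding vertex_type_def using assms
    by (simp add: hor_cong[of "x - 1" "x' - 1"] hor_cong[of x x'] ver_cong[of x x'])
qed

lemma movable_cong:
  assumes "x mod int M = x' mod int M"
  shows "movable M N d \<sigma> y x = movable M N d \<sigma> y x'"
  unfolding movable_def using assms by (metis hor_cong)

lemma all_movable: "(\<forall>i\<in>{0..<int M}. movable M N d \<sigma> y i) \<longleftrightarrow> (\<forall>i. movable M N d \<sigma> y i)"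
  using movable_cong[of "i mod int M" i d \<sigma> y for i] by fastforce

text \<open>An equation for arbitrary integer coordinates, so that neighbours such as
  \<open>x - 1\<close> need no reduction into the fundamental range.\<close>

definition conserve :: "config \<Rightarrow> int \<Rightarrow> int \<Rightarrow> bool" where
  "conserve \<sigma> x y \<longleftrightarrow>
     of_bool (\<sigma> (ver M N x (y - 1))) + of_bool (\<sigma> (hor M N (x - 1) y)) =
     (of_bool (\<sigma> (ver M N x y)) + of_bool (\<sigma> (hor M N x y)) :: nat)"

lemma conserve_cong:
  assumes "x mod int M = x' mod int M" "y mod int N = y' mod int N"
  shows "conserve \<sigma> x y = conserve \<sigma> x' y'"
  using vertex_type_cong[OF assms, of \<sigma>] by (simp add: conserve_def vertex_type_def)

lemma path_configs_iff:
  "\<sigma> \<in> path_configs M N \<longleftrightarrow>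
     (\<forall>e. e \<notin> torus_edges M N \<longrightarrow> \<not> \<sigma> e) \<and> (\<forall>x y. conserve \<sigma> x y)"
proof -
  have "(\<forall>x\<in>{0..<int M}. \<forall>y\<in>{0..<int N}. conserve \<sigma> x y) \<longleftrightarrow> (\<forall>x y. conserve \<sigma> x y)"
    using conserve_cong[of "x mod int M" x "y mod int N" y \<sigma> for x y] by fastforce
  then show ?thesis
    unfolding path_configs_def by (simp add: vertex_type_def conserve_def)
qed

lemma conserveD: "\<sigma> \<in> path_configs M N \<Longrightarrow> conserve \<sigma> x y"
  by (simp add: path_configs_iff)

lemma hor_in_torus [simp]: "hor M N x y \<in> torus_edges M N"
  and ver_in_torus [simp]: "ver M N x y \<in> torus_edges M N"
  unfolding hor_def ver_def torus_edges_def using M N by auto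

lemma torus_edge_cases:
  assumes "e \<in> torus_edges M N"
  obtains x y where "e = hor M N x y" | x y where "e = ver M N x y"
  using assms unfolding torus_edges_def hor_def ver_def
  by (auto; metis mod_pos_pos_trivial)

lemma finite_path_configs: "finite (path_configs M N)"
proof (rule finite_subset)
  show "path_configs M N \<subseteq> (\<lambda>E e. e \<in> E) ` Pow (torus_edges M N)"
  proof
    fix \<sigma> assume "\<sigma> \<in> path_configs M N"
    then have "\<sigma> = (\<lambda>e. e \<in> Collect \<sigma>)" "Collect \<sigma> \<subseteq> torus_edges M N"
      by (auto simp: path_configs_iff)
    then show "\<sigma> \<in> (\<lambda>E e. e \<in> E) ` Pow (torus_edges M N)" by blast
  qed
  have "torus_edges M N =
      (\<lambda>(x, y). Hor x y) ` ({0..<int M} \<times> {0..<int N}) \<union> (\<lambda>(x, y). Ver x y) ` ({0..<int M} \<times> {0..<int N})"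
    unfolding torus_edges_def by auto
  then show "finite ((\<lambda>E e. e \<in> E) ` Pow (torus_edges M N))" by simp
qed

text \<open>\<open>(i - x) mod int M\<close> is the distance from column \<open>x\<close> to column \<open>i\<close>, going right.\<close>

lemma arc_hor:
  assumes "c + 1 < M"
  shows "arc_jump M N d x y c \<sigma> (hor M N i y') =
    (if (i - x) mod int M \<le> int c \<and> y' mod int N = y mod int N then \<not> d
     else if (i - x) mod int M \<le> int c \<and> y' mod int N = (y + 1) mod int N then d
     else \<sigma> (hor M N i y'))"
proof -
  have "(\<exists>j\<le>c. i mod int M = (x + int j) mod int M) \<longleftrightarrow> (i - x) mod int M \<le> int c"
  proof
    assume "\<exists>j\<le>c. i mod int M = (x + int j) mod int M"
    then obtain j where "j \<le> c" "i mod int M = (x + int j) mod int M" by blast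
    then show "(i - x) mod int M \<le> int c"
      using assms mod_eq_add_iff[of j "int M" i x] by auto
  next
    assume le: "(i - x) mod int M \<le> int c"
    then have "nat ((i - x) mod int M) \<le> c" by simp
    moreover have "i mod int M = (x + int (nat ((i - x) mod int M))) mod int M"
      by (simp add: mod_add_right_eq)
    ultimately show "\<exists>j\<le>c. i mod int M = (x + int j) mod int M" by blast
  qed
  then show ?thesis unfolding arc_jump_def by auto
qed

lemma arc_ver:
  assumes "c + 1 < M"
  shows "arc_jump M N d x y c \<sigma> (ver M N i y') =
    (if y' mod int N = y mod int N \<and> (i - x) mod int M = 0 then d
     else if y' mod int N = y mod int N \<and> (i - x) mod int M = int c + 1 then \<not> d
     else \<sigma> (ver M N i y'))"
  unfolding arc_jump_def using assms mod_eq_add_iff[of 0 "int M" i x] mod_eq_add_iff[of "c + 1" "int M" i x]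
  by (auto simp: add_ac)

lemma arc_outside: "e \<notin> torus_edges M N \<Longrightarrow> arc_jump M N d x y c \<sigma> e = \<sigma> e"
  unfolding arc_jump_def by auto

lemma arc_column_cong:
  assumes "x mod int M = x' mod int M"
  shows "arc_jump M N d x y c \<sigma> = arc_jump M N d x' y c \<sigma>"
proof -
  have "(x + int j) mod int M = (x' + int j) mod int M" for j
    using assms by (metis mod_add_left_eq)
  from this this[of "c + 1"] have *: "hor M N (x + int j) z = hor M N (x' + int j) z"
    "ver M N (x + int c + 1) z = ver M N (x' + int c + 1) z" "ver M N x z = ver M N x' z" for j z
    using assms by (simp_all add: add_ac)
  show ?thesis unfolding arc_jump_def by (simp only: *)
qed

lemma loop_hor:
  "loop_jump M N d y \<sigma> (hor M N i y') =
    (if y' mod int N = y mod int N then \<not> d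
     else if y' mod int N = (y + 1) mod int N then d
     else \<sigma> (hor M N i y'))"
proof -
  have "\<exists>j\<in>{0..<int M}. i mod int M = j mod int M"
    by (intro bexI[of _ "i mod int M"]) auto
  then show ?thesis unfolding loop_jump_def by auto
qed

lemma loop_ver: "loop_jump M N d y \<sigma> (ver M N i y') = \<sigma> (ver M N i y')"
  unfolding loop_jump_def by auto

lemma loop_outside: "e \<notin> torus_edges M N \<Longrightarrow> loop_jump M N d y \<sigma> e = \<sigma> e"
  unfolding loop_jump_def by auto

lemma movable_offset:
  assumes "\<And>j. j \<le> c \<Longrightarrow> movable M N d \<sigma> y (x + int j)" "(i - x) mod int M \<le> int c"
  shows "movable M N d \<sigma> y i"
proof -
  have "nat ((i - x) mod int M) \<le> c" using assms(2) by simp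
  then have "movable M N d \<sigma> y (x + int (nat ((i - x) mod int M)))" by (rule assms(1))
  moreover have "(x + int (nat ((i - x) mod int M))) mod int M = i mod int M"
    by (simp add: mod_add_right_eq)
  ultimately show ?thesis using movable_cong by blast
qed

lemma offset_pred:
  "(i - 1 - x) mod int M = (if (i - x) mod int M = 0 then int M - 1 else (i - x) mod int M - 1)"
  using mod_minus_one[of "int M" "i - x"] M by (simp add: algebra_simps)

lemma offset_zeroD: "(i - x) mod int M = 0 \<Longrightarrow> i mod int M = x mod int M"
  using mod_eq_add_iff[of 0 "int M" i x] M by simp

lemma offset_succD:
  "(i - x) mod int M = int c + 1 \<Longrightarrow> c + 1 < M \<Longrightarrow> i mod int M = (x + int c + 1) mod int M"
  using mod_eq_add_iff[of "c + 1" "int M" i x] by (simp add: add_ac)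

section \<open>Jumps keep the conservation law and can be undone\<close>

lemma row_cases:
  fixes y y' :: int
  obtains "y' mod int N = y mod int N" | "y' mod int N = (y + 1) mod int N"
  | "y' mod int N \<noteq> y mod int N" "y' mod int N \<noteq> (y + 1) mod int N" "(y' - 1) mod int N \<noteq> y mod int N"
  by (metis diff_add_cancel mod_add_left_eq)

text \<open>At each affected vertex exactly two edges change, and their changes compensate. Inside
  the stretch these are the left and the right edge. At the seed they are the vertical edge and the
  right edge, at the end the vertical edge and the left edge. Maximality of the stretch is not
  assumed, so the lemma also serves for reversed jumps.\<close>

lemma arc_path_configs:
  assumes \<sigma>: "\<sigma> \<in> path_configs M N" and c: "c + 1 < M"
    and run: "\<And>j. j \<le> c \<Longrightarrow> movable M N d \<sigma> y (x + int j)"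
    and first: "\<sigma> (ver M N x y) = (\<not> d)" and last: "\<sigma> (ver M N (x + int c + 1) y) = d"
  shows "arc_jump M N d x y c \<sigma> \<in> path_configs M N"
proof -
  define \<sigma>' where "\<sigma>' = arc_jump M N d x y c \<sigma>"
  have "conserve \<sigma>' i y'" for i y'
  proof -
    define k where "k = (i - x) mod int M"
    note arcs = \<sigma>'_def arc_hor[OF c] arc_ver[OF c] offset_pred k_def[symmetric]
    have k: "0 \<le> k" "k < int M" by (simp_all add: k_def)
    have first': "\<sigma> (ver M N i y) = (\<not> d)" if "k = 0"
      using that first offset_zeroD[of i x] unfolding k_def by (metis ver_cong)
    have last': "\<sigma> (ver M N i y) = d" if "k = int c + 1"
      using that last offset_succD[of i x c] c unfolding k_def by (metis ver_cong)
    have here: "\<sigma> (hor M N i y) = d" "\<sigma> (hor M N i (y + 1)) = (\<not> d)" if "k \<le> int c"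
      using movable_offset[OF run, of c i] that by (auto simp: k_def movable_def)
    have left: "\<sigma> (hor M N (i - 1) y) = d" "\<sigma> (hor M N (i - 1) (y + 1)) = (\<not> d)"
      if "k \<noteq> 0" "k \<le> int c + 1"
      using movable_offset[OF run, of c "i - 1"] that by (auto simp: k_def movable_def offset_pred)
    consider (start) "k = 0" | (middle) "k \<noteq> 0" "k \<le> int c" | (stop) "k = int c + 1"
      | (rest) "k \<noteq> 0" "\<not> k \<le> int c" "\<not> k - 1 \<le> int c" "k \<noteq> int c + 1"
      using k by linarith
    note cases = this
    \<comment> \<open>In the seed column the left neighbour has offset \<open>M - 1\<close>; it must
      not be mistaken for a column of the stretch.\<close>
    have wrap: "\<not> int M - 1 \<le> int c" using c by linarith
    show ?thesis
    proof (rule row_cases[of y' y])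
      assume "y' mod int N = y mod int N"
      moreover have "conserve \<sigma>' i y"
      proof (cases rule: cases)
        case start
        then show ?thesis
          using conserveD[OF \<sigma>, of i y] unfolding conserve_def
          by (cases d) (simp_all add: arcs first' here wrap)
      next
        case middle
        then show ?thesis
          using conserveD[OF \<sigma>, of i y] unfolding conserve_def
          by (cases d) (simp_all add: arcs here left)
      next
        case stop
        then show ?thesis
          using conserveD[OF \<sigma>, of i y] unfolding conserve_def
          by (cases d) (simp_all add: arcs last' left)
      next
        case rest
        then show ?thesis
          using conserveD[OF \<sigma>, of i y] unfolding conserve_def by (simp add: arcs)
      qed
      ultimately show ?thesis by (simp add: conserve_cong[of i i y' y])
    next
      assume "y' mod int N = (y + 1) mod int N"
      moreover have "conserve \<sigma>' i (y + 1)"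
      proof (cases rule: cases)
        case start
        then show ?thesis
          using conserveD[OF \<sigma>, of i "y + 1"] unfolding conserve_def
          by (cases d) (simp_all add: arcs first' here wrap)
      next
        case middle
        then show ?thesis
          using conserveD[OF \<sigma>, of i "y + 1"] unfolding conserve_def
          by (cases d) (simp_all add: arcs here left)
      next
        case stop
        then show ?thesis
          using conserveD[OF \<sigma>, of i "y + 1"] unfolding conserve_def
          by (cases d) (simp_all add: arcs last' left)
      next
        case rest
        then show ?thesis
          using conserveD[OF \<sigma>, of i "y + 1"] unfolding conserve_def by (simp add: arcs)
      qed
      ultimately show ?thesis by (simp add: conserve_cong[of i i y' "y + 1"])
    next
      assume "y' mod int N \<noteq> y mod int N" "y' mod int N \<noteq> (y + 1) mod int N"
        "(y' - 1) mod int N \<noteq> y mod int N"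
      then show ?thesis
        using conserveD[OF \<sigma>, of i y'] unfolding conserve_def by (simp add: arcs)
    qed
  qed
  then show ?thesis
    using \<sigma> unfolding path_configs_iff by (auto simp: arc_outside \<sigma>'_def)
qed

lemma loop_path_configs:
  assumes \<sigma>: "\<sigma> \<in> path_configs M N" and all: "\<And>i. movable M N d \<sigma> y i"
  shows "loop_jump M N d y \<sigma> \<in> path_configs M N"
proof -
  have here: "\<sigma> (hor M N i y) = d" "\<sigma> (hor M N i (y + 1)) = (\<not> d)" for i
    using all[of i] by (auto simp: movable_def)
  have "conserve (loop_jump M N d y \<sigma>) i y'" for i y'
  proof (rule row_cases[of y' y])
    assume "y' mod int N = y mod int N"
    moreover have "conserve (loop_jump M N d y \<sigma>) i y"
      using conserveD[OF \<sigma>, of i y] unfolding conserve_def by (simp add: loop_hor loop_ver here)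
    ultimately show ?thesis by (simp add: conserve_cong[of i i y' y])
  next
    assume "y' mod int N = (y + 1) mod int N"
    moreover have "conserve (loop_jump M N d y \<sigma>) i (y + 1)"
      using conserveD[OF \<sigma>, of i "y + 1"] unfolding conserve_def by (simp add: loop_hor loop_ver here)
    ultimately show ?thesis by (simp add: conserve_cong[of i i y' "y + 1"])
  next
    assume "y' mod int N \<noteq> y mod int N" "y' mod int N \<noteq> (y + 1) mod int N"
    then show ?thesis
      using conserveD[OF \<sigma>, of i y'] unfolding conserve_def by (simp add: loop_hor loop_ver)
  qed
  then show ?thesis
    using \<sigma> unfolding path_configs_iff by (auto simp: loop_outside)
qed

text \<open>The hypotheses fix the old state of every edge that is overwritten, so writing the
  opposite values onto the same stretch restores the configuration.\<close>

lemma arc_jump_inverse: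
  assumes c: "c + 1 < M"
    and run: "\<And>j. j \<le> c \<Longrightarrow> movable M N d \<sigma> y (x + int j)"
    and first: "\<sigma> (ver M N x y) = (\<not> d)" and last: "\<sigma> (ver M N (x + int c + 1) y) = d"
  shows "arc_jump M N (\<not> d) x y c (arc_jump M N d x y c \<sigma>) = \<sigma>"
proof
  fix e
  have here: "\<sigma> (hor M N i y) = d" "\<sigma> (hor M N i (y + 1)) = (\<not> d)" if "(i - x) mod int M \<le> int c" for i
    using movable_offset[OF run, of c i] that by (auto simp: movable_def)
  have first': "\<sigma> (ver M N i y) = (\<not> d)" if "(i - x) mod int M = 0" for i
    using that first offset_zeroD[of i x] by (metis ver_cong)
  have last': "\<sigma> (ver M N i y) = d" if "(i - x) mod int M = int c + 1" for i
    using that last offset_succD[of i x c] c by (metis ver_cong)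
  have row: "\<sigma> (hor M N i y') = \<sigma> (hor M N i z)" "\<sigma> (ver M N i y') = \<sigma> (ver M N i z)"
    if "y' mod int N = z mod int N" for i y' z
    using that by (metis hor_cong, metis ver_cong)
  show "arc_jump M N (\<not> d) x y c (arc_jump M N d x y c \<sigma>) e = \<sigma> e"
  proof (cases "e \<in> torus_edges M N")
    case True
    then show ?thesis
    proof (cases rule: torus_edge_cases)
      case (1 i y')
      then show ?thesis
        by (simp add: arc_hor[OF c] here row(1)[of y' y] row(1)[of y' "y + 1"])
    next
      case (2 i y')
      then show ?thesis
        by (simp add: arc_ver[OF c] first' last' row(2)[of y' y])
    qed
  qed (simp add: arc_outside)
qed

lemma loop_jump_inverse:
  assumes all: "\<And>i. movable M N d \<sigma> y i"
  shows "loop_jump M N (\<not> d) y (loop_jump M N d y \<sigma>) = \<sigma>"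
proof
  fix e
  have h: "\<sigma> (hor M N i y) = d" "\<sigma> (hor M N i (y + 1)) = (\<not> d)" for i
    using all[of i] by (auto simp: movable_def)
  show "loop_jump M N (\<not> d) y (loop_jump M N d y \<sigma>) e = \<sigma> e"
    unfolding loop_jump_def[of M N "\<not> d"] using h by (auto simp: loop_jump_def)
qed

end

section \<open>Height changes\<close>

text \<open>A relation between two configurations without reference to \<open>k1\<close> and
  \<open>k2\<close>: the balance computation then works for every density that depends on the
  heights only, and a sector indicator is such a density.\<close>

definition same_heights :: "nat \<Rightarrow> nat \<Rightarrow> config \<Rightarrow> config \<Rightarrow> bool" where
  "same_heights M N \<sigma> \<sigma>' \<longleftrightarrow>
     (\<forall>y. card {x\<in>{0..<int M}. \<sigma>' (ver M N x y)} = card {x\<in>{0..<int M}. \<sigma> (ver M N x y)}) \<and>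
     (\<forall>x. card {y\<in>{0..<int N}. \<sigma>' (hor M N x y)} = card {y\<in>{0..<int N}. \<sigma> (hor M N x y)})"

lemma sector_same_heights:
  "\<sigma> \<in> path_configs M N \<Longrightarrow> \<sigma>' \<in> path_configs M N \<Longrightarrow> same_heights M N \<sigma> \<sigma>' \<Longrightarrow>
     \<sigma>' \<in> sector M N k1 k2 \<longleftrightarrow> \<sigma> \<in> sector M N k1 k2"
  by (simp add: sector_def same_heights_def)

lemma card_Collect_transpose:
  assumes "a \<in> A" "b \<in> A" "\<And>i. i \<in> A \<Longrightarrow> P (Transposition.transpose a b i) = Q i"
  shows "card {i \<in> A. Q i} = card {i \<in> A. P i}"
proof (rule bij_betw_same_card[of "Transposition.transpose a b"])
  show "bij_betw (Transposition.transpose a b) {i \<in> A. Q i} {i \<in> A. P i}"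
  proof (rule bij_betwI[where g = "Transposition.transpose a b"])
    have A: "Transposition.transpose a b i \<in> A" if "i \<in> A" for i
      using that assms(1,2) by (auto simp: Transposition.transpose_def)
    then show "Transposition.transpose a b \<in> {i \<in> A. Q i} \<rightarrow> {i \<in> A. P i}"
      using assms(3) by auto
    show "Transposition.transpose a b \<in> {i \<in> A. P i} \<rightarrow> {i \<in> A. Q i}"
      using A assms(3)[of "Transposition.transpose a b i" for i] by auto
  qed auto
qed

context torus
begin

lemma card_column_swap:
  assumes "\<sigma>' (hor M N i y) = \<sigma> (hor M N i (y + 1))" "\<sigma>' (hor M N i (y + 1)) = \<sigma> (hor M N i y)"
    and other: "\<And>y'. y' mod int N \<noteq> y mod int N \<Longrightarrow> y' mod int N \<noteq> (y + 1) mod int N \<Longrightarrow>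
           \<sigma>' (hor M N i y') = \<sigma> (hor M N i y')"
  shows "card {y\<in>{0..<int N}. \<sigma>' (hor M N i y)} = card {y\<in>{0..<int N}. \<sigma> (hor M N i y)}"
proof (rule card_Collect_transpose[where a = "y mod int N" and b = "(y + 1) mod int N"])
  have m: "hor M N i (z mod int N) = hor M N i z" for z by simp
  fix y' assume y': "y' \<in> {0..<int N}"
  show "\<sigma> (hor M N i (Transposition.transpose (y mod int N) ((y + 1) mod int N) y')) = \<sigma>' (hor M N i y')"
    using assms(1,2) other[of y'] y'
    by (auto simp: Transposition.transpose_def m simp del: hor_eq_iff)
qed auto

lemma arc_same_heights:
  assumes c: "c + 1 < M"
    and run: "\<And>j. j \<le> c \<Longrightarrow> movable M N d \<sigma> y (x + int j)"
    and first: "\<sigma> (ver M N x y) = (\<not> d)" and last: "\<sigma> (ver M N (x + int c + 1) y) = d"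
  shows "same_heights M N \<sigma> (arc_jump M N d x y c \<sigma>)"
proof -
  define \<sigma>' where "\<sigma>' = arc_jump M N d x y c \<sigma>"
  let ?e = "x + int c + 1"
  have m: "ver M N (z mod int M) y' = ver M N z y'" for z y' by simp
  have row: "card {x\<in>{0..<int M}. \<sigma>' (ver M N x y')} = card {x\<in>{0..<int M}. \<sigma> (ver M N x y')}" for y'
  proof (cases "y' mod int N = y mod int N")
    case True
    then have v: "ver M N i y' = ver M N i y" for i by simp
    show ?thesis unfolding v
    \<comment> \<open>Along row \<open>y\<close> the jump merely exchanges the states of the first
      and the last vertical edge.\<close>
    proof (rule card_Collect_transpose[where a = "x mod int M" and b = "?e mod int M"])
      fix i assume i: "i \<in> {0..<int M}"
      have i': "i = i mod int M" using i by simp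
      have "(i - x) mod int M = 0 \<longleftrightarrow> i = x mod int M"
        using mod_eq_add_iff[of 0 "int M" i x] c i by simp
      moreover have "(i - x) mod int M = int c + 1 \<longleftrightarrow> i = ?e mod int M"
        using mod_eq_add_iff[of "c + 1" "int M" i x] c i by (simp add: add_ac)
      ultimately have "\<sigma>' (ver M N i y) = (if i = x mod int M then d else if i = ?e mod int M
          then \<not> d else \<sigma> (ver M N i y))"
        by (simp add: \<sigma>'_def arc_ver[OF c])
      then show "\<sigma> (ver M N (Transposition.transpose (x mod int M) (?e mod int M) i) y) = \<sigma>' (ver M N i y)"
        using first last by (auto simp: Transposition.transpose_def m simp del: ver_eq_iff)
    qed auto
  next
    case False
    then show ?thesis by (simp add: \<sigma>'_def arc_ver[OF c])
  qed
  have col: "card {y\<in>{0..<int N}. \<sigma>' (hor M N i y)} = card {y\<in>{0..<int N}. \<sigma> (hor M N i y)}" for i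
  proof (cases "(i - x) mod int M \<le> int c")
    case True
    then show ?thesis
      using movable_offset[OF run True]
      by (intro card_column_swap[where y = y]) (auto simp: \<sigma>'_def arc_hor[OF c] movable_def)
  next
    case False
    then show ?thesis by (simp add: \<sigma>'_def arc_hor[OF c])
  qed
  from row col show ?thesis by (simp add: same_heights_def \<sigma>'_def)
qed

lemma loop_same_heights:
  assumes all: "\<And>i. movable M N d \<sigma> y i"
  shows "same_heights M N \<sigma> (loop_jump M N d y \<sigma>)"
proof -
  have "card {y'\<in>{0..<int N}. loop_jump M N d y \<sigma> (hor M N i y')} = card {y'\<in>{0..<int N}. \<sigma> (hor M N i y')}" for i
    using all[of i] by (intro card_column_swap[where y = y]) (auto simp: loop_hor movable_def)
  then show ?thesis by (simp add: same_heights_def loop_ver)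
qed

end

section \<open>Weights and rates\<close>

text \<open>The seed rates of the time reversed process, whose jumps run to the left.\<close>

definition rev_seed_rate ::
  "real \<Rightarrow> real \<Rightarrow> real \<Rightarrow> bool \<Rightarrow> vtype \<Rightarrow> vtype \<Rightarrow> real" where
  "rev_seed_rate C A B d t1 t2 =
     (if d then
        (if t1 = (0,0,0,0) \<and> t2 = (0,1,0,1) then C
         else if t1 = (0,0,0,0) \<and> t2 = (0,1,1,0) then A
         else if t1 = (1,0,0,1) \<and> t2 = (0,1,0,1) then B
         else 0)
      else
        (if t1 = (1,1,1,1) \<and> t2 = (1,0,1,0) then C
         else if t1 = (1,1,1,1) \<and> t2 = (1,0,0,1) then A
         else if t1 = (0,1,1,0) \<and> t2 = (1,0,1,0) then B
         else 0))"

abbreviation vt :: "bool \<Rightarrow> bool \<Rightarrow> bool \<Rightarrow> bool \<Rightarrow> vtype" where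
  "vt i j k l \<equiv> (of_bool i, of_bool j, of_bool k, of_bool l)"

abbreviation kirchhoff :: "bool \<Rightarrow> bool \<Rightarrow> bool \<Rightarrow> bool \<Rightarrow> bool" where
  "kirchhoff i j k l \<equiv> of_bool i + of_bool j = (of_bool k + of_bool l :: nat)"

text \<open>
  The vertical pairs \<open>p\<close>, \<open>q\<close> of vertices contribute a telescoping sum: the first two terms along
  columns, the last one along rows.
\<close>

lemma rate_difference_local:
  fixes A B C :: real
  defines "\<alpha> \<equiv> \<lambda>t::vtype. of_bool (t = (0,0,0,0) \<or> t = (1,1,1,1))"
    and "\<beta> \<equiv> \<lambda>t::vtype. of_bool (t = (1,0,1,0) \<or> t = (0,1,0,1))"
    and "\<delta> \<equiv> \<lambda>l u. of_bool (l \<noteq> (u::bool))"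
  assumes "kirchhoff b l v L" "kirchhoff v u t U"
  shows "(\<Sum>d\<in>UNIV. rev_seed_rate C A B d (vt b l v L) (vt v u t U)
            - seed_rate C A B d (vt b l v L) (vt v u t U)) =
     ((A + C - B) * (\<alpha> (vt b l v L) - \<alpha> (vt v u t U))
      + (B + C - A) * (\<beta> (vt v u t U) - \<beta> (vt b l v L))
      + (A + B - C) * (\<delta> l u - \<delta> L U)) / 2"
  using assms(4,5) unfolding \<alpha>_def \<beta>_def \<delta>_def UNIV_bool
  by (cases b; cases l; cases v; cases L; cases u; cases t; cases U)
     (simp_all add: rev_seed_rate_def seed_rate_def)

section \<open>Time reversal and balance\<close>

text \<open>Stated for a predicate on offsets, so that it can be used to the right from a seed and
  to the left from the end of a stretch. The witness at offset \<open>j < m\<close> keeps the run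
  and its stopping column within one turn around the torus.\<close>

lemma exists_run:
  fixes m :: nat and P :: "int \<Rightarrow> bool"
  assumes "P 0" "\<not> P (int j)" "j < m"
  obtains c where "c + 1 < m" "\<And>j. j \<le> c \<Longrightarrow> P (int j)" "\<not> P (int c + 1)"
proof -
  define k where "k = (LEAST k. \<not> P (int k))"
  have k: "\<not> P (int k)"
    unfolding k_def by (rule LeastI[where P = "\<lambda>k. \<not> P (int k)"]) (rule assms(2))
  have "k \<le> j"
    unfolding k_def by (rule Least_le) (rule assms(2))
  have "k \<noteq> 0" using k(1) assms(1) by (metis of_nat_0)
  moreover have "P (int i)" if "i < k" for i
    using not_less_Least[of i "\<lambda>k. \<not> P (int k)"] that by (simp add: k_def)
  ultimately show thesis
    using that[of "k - 1"] k \<open>k \<le> j\<close> assms(3) by (auto simp: of_nat_diff)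
qed

lemma run_unique:
  fixes P :: "int \<Rightarrow> bool"
  assumes "\<And>j. j \<le> c \<Longrightarrow> P (int j)" "\<not> P (int c + 1)"
    and "\<And>j. j \<le> c' \<Longrightarrow> P (int j)" "\<not> P (int c' + 1)"
  shows "c = c'"
proof -
  have "\<not> c < c'" using assms(2) assms(3)[of "Suc c"] by (auto simp: add.commute)
  moreover have "\<not> c' < c" using assms(4) assms(1)[of "Suc c'"] by (auto simp: add.commute)
  ultimately show ?thesis by simp
qed

lemma sum_periodic_shift:
  fixes f :: "int \<Rightarrow> real"
  assumes "n > 0" "\<And>i j. i mod int n = j mod int n \<Longrightarrow> f i = f j"
  shows "(\<Sum>i\<in>{0..<int n}. f (i + 1)) = (\<Sum>i\<in>{0..<int n}. f i)"
proof -
  have "(\<Sum>i\<in>{0..<int n}. f (i + 1)) = sum f {1..<int n + 1}"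
    by (rule sum.reindex_bij_witness[of _ "\<lambda>i. i - 1" "\<lambda>i. i + 1"]) auto
  also have "{1..<int n + 1} = insert (int n) {1..<int n}" using assms(1) by auto
  also have "sum f \<dots> = f (int n) + sum f {1..<int n}" by simp
  also have "f (int n) = f 0" by (rule assms(2)) simp
  also have "f 0 + sum f {1..<int n} = sum f (insert 0 {1..<int n})" by simp
  also have "insert 0 {1..<int n} = {0..<int n}" using assms(1) by auto
  finally show ?thesis .
qed

context torus
begin

definition pair_weight :: "(vtype \<Rightarrow> real) \<Rightarrow> config \<Rightarrow> int \<Rightarrow> int \<Rightarrow> real" where
  "pair_weight w \<sigma> y i = w (vertex_type M N \<sigma> i y) * w (vertex_type M N \<sigma> i (y + 1))"

text \<open>The contribution of the other rows is a common factor \<open>R\<close>. Keeping it as a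
  factor avoids quotients of weights.\<close>

lemma config_weight_rows:
  assumes other: "\<And>i y'. y' mod int N \<noteq> y mod int N \<Longrightarrow> y' mod int N \<noteq> (y + 1) mod int N \<Longrightarrow>
      vertex_type M N \<sigma>' i y' = vertex_type M N \<sigma> i y'"
  obtains R where "config_weight M N w \<sigma> = (\<Prod>i\<in>{0..<int M}. pair_weight w \<sigma> y i) * R"
    "config_weight M N w \<sigma>' = (\<Prod>i\<in>{0..<int M}. pair_weight w \<sigma>' y i) * R"
proof -
  let ?O = "{0..<int N} - {y mod int N} - {(y + 1) mod int N}"
  have split: "config_weight M N w \<sigma> =
      (\<Prod>i\<in>{0..<int M}. pair_weight w \<sigma> y i) *
      (\<Prod>i\<in>{0..<int M}. \<Prod>y'\<in>?O. w (vertex_type M N \<sigma> i y'))" for \<sigma>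
  proof -
    have "(\<Prod>y'\<in>{0..<int N}. w (vertex_type M N \<sigma> i y')) =
        pair_weight w \<sigma> y i * (\<Prod>y'\<in>?O. w (vertex_type M N \<sigma> i y'))" for i
    proof -
      have "(\<Prod>y'\<in>{0..<int N}. w (vertex_type M N \<sigma> i y')) =
          w (vertex_type M N \<sigma> i (y mod int N)) * (\<Prod>y'\<in>{0..<int N} - {y mod int N}. w (vertex_type M N \<sigma> i y'))"
        by (rule prod.remove) auto
      also have "(\<Prod>y'\<in>{0..<int N} - {y mod int N}. w (vertex_type M N \<sigma> i y')) =
          w (vertex_type M N \<sigma> i ((y + 1) mod int N)) * (\<Prod>y'\<in>?O. w (vertex_type M N \<sigma> i y'))"
        by (rule prod.remove) auto
      finally show ?thesis
        by (simp add: pair_weight_def mult.assoc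
            vertex_type_cong[of i i "y mod int N" y] vertex_type_cong[of i i "(y + 1) mod int N" "y + 1"])
    qed
    then show ?thesis by (simp add: config_weight_def prod.distrib)
  qed
  have "(\<Prod>i\<in>{0..<int M}. \<Prod>y'\<in>?O. w (vertex_type M N \<sigma>' i y')) =
      (\<Prod>i\<in>{0..<int M}. \<Prod>y'\<in>?O. w (vertex_type M N \<sigma> i y'))"
  proof (intro prod.cong refl)
    fix i y' assume "y' \<in> ?O"
    then have "y' mod int N = y'" "y' \<noteq> y mod int N" "y' \<noteq> (y + 1) mod int N" by auto
    then show "w (vertex_type M N \<sigma>' i y') = w (vertex_type M N \<sigma> i y')"
      using other[of y' i] by simp
  qed
  with split[of \<sigma>] split[of \<sigma>'] that show thesis by metis
qed

lemma vertex_type_rows: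
  "vertex_type M N \<sigma> i y =
     vt (\<sigma> (ver M N i (y - 1))) (\<sigma> (hor M N (i - 1) y)) (\<sigma> (ver M N i y)) (\<sigma> (hor M N i y))"
  "vertex_type M N \<sigma> i (y + 1) =
     vt (\<sigma> (ver M N i y)) (\<sigma> (hor M N (i - 1) (y + 1))) (\<sigma> (ver M N i (y + 1))) (\<sigma> (hor M N i (y + 1)))"
  by (simp_all add: vertex_type_def)

lemma kirchhoff_rows:
  assumes "\<sigma> \<in> path_configs M N"
  shows "kirchhoff (\<sigma> (ver M N i (y - 1))) (\<sigma> (hor M N (i - 1) y)) (\<sigma> (ver M N i y)) (\<sigma> (hor M N i y))"
    "kirchhoff (\<sigma> (ver M N i y)) (\<sigma> (hor M N (i - 1) (y + 1))) (\<sigma> (ver M N i (y + 1))) (\<sigma> (hor M N i (y + 1)))"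
  using conserveD[OF assms, of i y] conserveD[OF assms, of i "y + 1"] by (simp_all add: conserve_def)

text \<open>If the vertical edge were in state \<open>\<not> d\<close>, conservation at its two end
  points would make the pair of horizontal edges to the right movable as well. Hence a run that
  stops always finds a vertical edge that the jump can change to \<open>\<not> d\<close>.\<close>

lemma arc_last_ver:
  assumes "\<sigma> \<in> path_configs M N" "movable M N d \<sigma> y (i - 1)" "\<not> movable M N d \<sigma> y i"
  shows "\<sigma> (ver M N i y) = d"
  using kirchhoff_rows[OF assms(1), of i y] assms(2,3) unfolding movable_def
  by (cases d; cases "\<sigma> (ver M N i y)") (auto simp: of_bool_def split: if_splits)

text \<open>The mirror image of \<open>arc_last_ver\<close>, needed where a run to the left
  stops.\<close>

lemma arc_first_ver:
  assumes "\<sigma> \<in> path_configs M N" "movable M N d \<sigma> y i" "\<not> movable M N d \<sigma> y (i - 1)"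
  shows "\<sigma> (ver M N i y) = (\<not> d)"
  using kirchhoff_rows[OF assms(1), of i y] assms(2,3) unfolding movable_def
  by (cases d; cases "\<sigma> (ver M N i y)") (auto simp: of_bool_def split: if_splits)

end

text \<open>The equations for \<open>K\<close> are precisely what the two ends of a stretch require,
  one for each kind of seed pair. They replace the square roots of the actual rates by polynomial
  relations.\<close>

locale six_vertex_torus = torus M N for M N +
  fixes a1 a2 b1 b2 c1 c2 A B C :: real and K :: "bool \<Rightarrow> real"
  assumes pos: "a1 > 0" "a2 > 0" "b1 > 0" "b2 > 0" "c1 > 0" "c2 > 0" "A > 0" "B > 0" "C > 0"
    and K_up: "C * (b2 * a1) = K True * (c1 * c2)" "A * a1 = K True * b1" "B * b2 = K True * a2"
    and K_down: "C * (b1 * a2) = K False * (c1 * c2)" "A * a2 = K False * b2" "B * b1 = K False * a1"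
begin

abbreviation w :: "vtype \<Rightarrow> real" where
  "w \<equiv> six_vertex_weight a1 a2 b1 b2 c1 c2"

abbreviation rate :: "bool \<Rightarrow> config \<Rightarrow> int \<Rightarrow> int \<Rightarrow> real" where
  "rate d \<sigma> x y \<equiv> seed_rate C A B d (vertex_type M N \<sigma> x y) (vertex_type M N \<sigma> x (y + 1))"

abbreviation rev_rate :: "bool \<Rightarrow> config \<Rightarrow> int \<Rightarrow> int \<Rightarrow> real" where
  "rev_rate d \<sigma> x y \<equiv> rev_seed_rate C A B d (vertex_type M N \<sigma> x y) (vertex_type M N \<sigma> x (y + 1))"

lemma seed_rate_neq_0:
  assumes "kirchhoff b l v L" "kirchhoff v u t U"
  shows "seed_rate C A B d (vt b l v L) (vt v u t U) \<noteq> 0 \<longleftrightarrow>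
    v = (\<not> d) \<and> L = d \<and> U = (\<not> d) \<and> \<not> (l = (\<not> d) \<and> u = d)"
  using assms pos
  by (cases d; cases b; cases l; cases v; cases L; cases u; cases t; cases U)
     (simp_all add: seed_rate_def)

lemma rev_seed_rate_neq_0:
  assumes "kirchhoff b l v L" "kirchhoff v u t U"
  shows "rev_seed_rate C A B d (vt b l v L) (vt v u t U) \<noteq> 0 \<longleftrightarrow>
    v = (\<not> d) \<and> l = (\<not> d) \<and> u = d \<and> \<not> (L = d \<and> U = (\<not> d))"
  using assms pos
  by (cases d; cases b; cases l; cases v; cases L; cases u; cases t; cases U)
     (simp_all add: rev_seed_rate_def)

text \<open>The last condition is what the list of seed types encodes by omission: if column
  \<open>x - 1\<close> were movable in direction \<open>\<not> d\<close>, a reversed run arriving at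
  \<open>x\<close> would continue past it and could not undo this jump.\<close>

lemma rate_neq_0:
  assumes "\<sigma> \<in> path_configs M N"
  shows "rate d \<sigma> x y \<noteq> 0 \<longleftrightarrow>
    \<sigma> (ver M N x y) = (\<not> d) \<and> movable M N d \<sigma> y x \<and> \<not> movable M N (\<not> d) \<sigma> y (x - 1)"
  using seed_rate_neq_0[OF kirchhoff_rows[OF assms, of x y], of d]
  by (auto simp: vertex_type_rows movable_def)

text \<open>Here the last condition says that the forward run which is being undone really stops in
  front of column \<open>x\<close>.\<close>

lemma rev_rate_neq_0:
  assumes "\<sigma> \<in> path_configs M N"
  shows "rev_rate d \<sigma> x y \<noteq> 0 \<longleftrightarrow>
    \<sigma> (ver M N x y) = (\<not> d) \<and> movable M N (\<not> d) \<sigma> y (x - 1) \<and> \<not> movable M N d \<sigma> y x"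
  using rev_seed_rate_neq_0[OF kirchhoff_rows[OF assms, of x y], of d]
  by (auto simp: vertex_type_rows movable_def)

text \<open>Each kind of seed uses one equation for \<open>K d\<close>. With rate \<open>C\<close>
  an a and a b vertex become the two c vertices; with rate \<open>A\<close> an a vertex is traded
  for a b vertex, with rate \<open>B\<close> a b vertex for an a vertex, next to a c type whose
  weight is retained.\<close>

lemma weight_start:
  assumes "kirchhoff b l (\<not> d) d" "kirchhoff (\<not> d) u t (\<not> d)" "\<not> (l = (\<not> d) \<and> u = d)"
  shows "w (vt b l (\<not> d) d) * w (vt (\<not> d) u t (\<not> d)) *
      seed_rate C A B d (vt b l (\<not> d) d) (vt (\<not> d) u t (\<not> d)) =
    K d * (w (vt b l d (\<not> d)) * w (vt d u t d))"
  using assms K_up K_down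
  by (cases d; cases b; cases l; cases u; cases t)
     (simp_all add: seed_rate_def six_vertex_weight_def mult_ac)

text \<open>Conservation forces \<open>b = v = t\<close>, so the two vertices simply exchange their
  types.\<close>

lemma weight_middle:
  assumes "kirchhoff b d v d" "kirchhoff v (\<not> d) t (\<not> d)"
  shows "w (vt b d v d) * w (vt v (\<not> d) t (\<not> d)) = w (vt b (\<not> d) v (\<not> d)) * w (vt v d t d)"
  using assms
  by (cases d; cases b; cases v; cases t) (simp_all add: six_vertex_weight_def)

text \<open>Rotation by 180 degrees turns this into \<open>weight_start\<close> with
  \<open>c1\<close> and \<open>c2\<close> exchanged, and the equations for \<open>K\<close> are
  symmetric in these two.\<close>

lemma weight_end:
  assumes "kirchhoff b d d L" "kirchhoff d (\<not> d) t U" "\<not> (L = d \<and> U = (\<not> d))"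
  shows "K d * (w (vt b d d L) * w (vt d (\<not> d) t U)) =
    w (vt b (\<not> d) (\<not> d) L) * w (vt (\<not> d) d t U) *
      rev_seed_rate C A B d (vt b (\<not> d) (\<not> d) L) (vt (\<not> d) d t U)"
  using assms K_up K_down
  by (cases d; cases b; cases L; cases U; cases t)
     (simp_all add: rev_seed_rate_def six_vertex_weight_def mult_ac)

text \<open>The condition at \<open>x + c + 1\<close> makes \<open>c\<close> the length of the
  forward run, and the condition at \<open>x - 1\<close> makes it the length of the reversed run
  after the jump; together they make jumps and reversed jumps correspond one to one. The bound
  \<open>c + 1 < M\<close> keeps the first and the last vertical edge in different columns.\<close>

definition arc_from :: "bool \<Rightarrow> int \<Rightarrow> int \<Rightarrow> nat \<Rightarrow> config \<Rightarrow> bool" where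
  "arc_from d x y c \<sigma> \<longleftrightarrow> c + 1 < M \<and> (\<forall>j\<le>c. movable M N d \<sigma> y (x + int j)) \<and>
     \<not> movable M N d \<sigma> y (x + int c + 1) \<and> \<not> movable M N (\<not> d) \<sigma> y (x - 1) \<and>
     \<sigma> (ver M N x y) = (\<not> d)"

lemma arc_fromD:
  assumes "arc_from d x y c \<sigma>" "\<sigma> \<in> path_configs M N"
  shows "c + 1 < M" "\<And>j. j \<le> c \<Longrightarrow> movable M N d \<sigma> y (x + int j)"
    "\<not> movable M N d \<sigma> y (x + int c + 1)" "\<not> movable M N (\<not> d) \<sigma> y (x - 1)"
    "\<sigma> (ver M N x y) = (\<not> d)" "\<sigma> (ver M N (x + int c + 1) y) = d"
proof -
  show "c + 1 < M" "\<And>j. j \<le> c \<Longrightarrow> movable M N d \<sigma> y (x + int j)"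
    "\<not> movable M N d \<sigma> y (x + int c + 1)" "\<not> movable M N (\<not> d) \<sigma> y (x - 1)"
    "\<sigma> (ver M N x y) = (\<not> d)"
    using assms(1) by (simp_all add: arc_from_def)
  then show "\<sigma> (ver M N (x + int c + 1) y) = d"
    by (intro arc_last_ver[OF assms(2)]) auto
qed

text \<open>The product over columns is split into the seed column, the end column and the rest. The
  rate is absorbed at the seed, travels as \<open>K d\<close> to the end column and reappears there
  as the reversed rate.\<close>

lemma arc_from_weight:
  assumes \<sigma>: "\<sigma> \<in> path_configs M N" and arc: "arc_from d x y c \<sigma>"
  defines "\<sigma>' \<equiv> arc_jump M N d x y c \<sigma>"
  shows "config_weight M N w \<sigma> * rate d \<sigma> x y = config_weight M N w \<sigma>' * rev_rate d \<sigma>' (x + int c + 1) y"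
proof -
  let ?e = "x + int c + 1"
  note [simp del] = hor_eq_iff ver_eq_iff
  note a = arc_fromD[OF arc \<sigma>]
  note c = a(1)
  note arcs = \<sigma>'_def arc_hor[OF c] arc_ver[OF c]
  have "vertex_type M N \<sigma>' i y' = vertex_type M N \<sigma> i y'"
    if "y' mod int N \<noteq> y mod int N" "y' mod int N \<noteq> (y + 1) mod int N" for i y'
    using row_cases[of y' y] that by (auto simp: vertex_type_def arcs)
  then obtain R where R: "config_weight M N w \<sigma> = (\<Prod>i\<in>{0..<int M}. pair_weight w \<sigma> y i) * R"
    "config_weight M N w \<sigma>' = (\<Prod>i\<in>{0..<int M}. pair_weight w \<sigma>' y i) * R"
    by (rule config_weight_rows)
  have offset_x: "(x - x) mod int M = 0" "(x - 1 - x) mod int M = int M - 1"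
    using offset_pred[of x x] by auto
  have offset_e: "(?e - x) mod int M = int c + 1" "(?e - 1 - x) mod int M = int c"
    using c by auto
  have mv0: "\<sigma> (hor M N x y) = d" "\<sigma> (hor M N x (y + 1)) = (\<not> d)"
    using a(2)[of 0] by (simp_all add: movable_def)
  have mvc: "\<sigma> (hor M N (?e - 1) y) = d" "\<sigma> (hor M N (?e - 1) (y + 1)) = (\<not> d)"
    using a(2)[of c] by (simp_all add: movable_def)
  have start: "pair_weight w \<sigma> y x * rate d \<sigma> x y = K d * pair_weight w \<sigma>' y x"
    using weight_start[of _ _ d] kirchhoff_rows[OF \<sigma>, of x y] a(4,5) mv0 c offset_x
    unfolding pair_weight_def vertex_type_rows movable_def by (simp add: arcs)
  have stop: "K d * pair_weight w \<sigma> y ?e = pair_weight w \<sigma>' y ?e * rev_rate d \<sigma>' ?e y"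
    using weight_end[of _ d] kirchhoff_rows[OF \<sigma>, of ?e y] a(3,6) mvc c offset_e
    unfolding pair_weight_def vertex_type_rows movable_def by (simp add: arcs)
  have same: "pair_weight w \<sigma> y i = pair_weight w \<sigma>' y i"
    if i: "i \<in> {0..<int M} - {x mod int M} - {?e mod int M}" for i
  proof -
    have i0: "(i - x) mod int M \<noteq> 0" using offset_zeroD[of i x] i by auto
    have ie: "(i - x) mod int M \<noteq> int c + 1" using offset_succD[of i x c] c i by auto
    show ?thesis
    proof (cases "(i - x) mod int M \<le> int c")
      case True
      have here: "\<sigma> (hor M N i y) = d" "\<sigma> (hor M N i (y + 1)) = (\<not> d)"
        using movable_offset[OF a(2) True] by (auto simp: movable_def)
      have left: "\<sigma> (hor M N (i - 1) y) = d" "\<sigma> (hor M N (i - 1) (y + 1)) = (\<not> d)"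
        using movable_offset[OF a(2), of c "i - 1"] True i0 by (auto simp: movable_def offset_pred)
      show ?thesis
        using weight_middle[of _ d] kirchhoff_rows[OF \<sigma>, of i y] here left i0 ie True
        unfolding pair_weight_def vertex_type_rows by (simp add: arcs offset_pred)
    next
      case False
      then show ?thesis
        using i0 ie unfolding pair_weight_def vertex_type_rows by (auto simp: arcs offset_pred)
    qed
  qed
  have ne: "x mod int M \<noteq> ?e mod int M"
    using mod_eq_add_iff[of 0 "int M" ?e x] c offset_e by simp
  \<comment> \<open>The product runs over representatives, whereas \<open>x\<close> and the end
    column are arbitrary integers.\<close>
  have cong: "pair_weight w s y (i mod int M) = pair_weight w s y i" for s i
    by (simp add: pair_weight_def vertex_type_cong[of "i mod int M" i])
  have prod: "(\<Prod>i\<in>{0..<int M}. pair_weight w s y i) = pair_weight w s y x * pair_weight w s y ?e *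
      (\<Prod>i\<in>{0..<int M} - {x mod int M} - {?e mod int M}. pair_weight w s y i)" for s
    using prod.remove[of "{0..<int M}" "x mod int M" "pair_weight w s y"]
      prod.remove[of "{0..<int M} - {x mod int M}" "?e mod int M" "pair_weight w s y"] ne
    by (simp add: cong mult.assoc)
  define Q where "Q = (\<Prod>i\<in>{0..<int M} - {x mod int M} - {?e mod int M}. pair_weight w \<sigma>' y i)"
  have "config_weight M N w \<sigma> * rate d \<sigma> x y =
      (pair_weight w \<sigma> y x * rate d \<sigma> x y) * pair_weight w \<sigma> y ?e * Q * R"
    unfolding R(1) prod Q_def using same by (simp add: mult_ac)
  also have "\<dots> = pair_weight w \<sigma>' y x * (K d * pair_weight w \<sigma> y ?e) * Q * R"
    by (simp add: start mult_ac)
  also have "\<dots> = config_weight M N w \<sigma>' * rev_rate d \<sigma>' ?e y"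
    unfolding R(2) prod stop Q_def by (simp add: mult_ac)
  finally show ?thesis .
qed

text \<open>Every column is an interior column, so the weight does not change, and the vertical
  edges at a column are all equal. The rate is therefore \<open>C\<close> or 0, and the reversed
  rate in the same column takes the same value.\<close>

lemma loop_weight:
  assumes \<sigma>: "\<sigma> \<in> path_configs M N" and all: "\<And>i. movable M N d \<sigma> y i"
  defines "\<sigma>' \<equiv> loop_jump M N d y \<sigma>"
  shows "config_weight M N w \<sigma> * rate d \<sigma> x y = config_weight M N w \<sigma>' * rev_rate d \<sigma>' x y"
proof -
  note [simp del] = hor_eq_iff ver_eq_iff
  have mv: "\<sigma> (hor M N i y) = d" "\<sigma> (hor M N i (y + 1)) = (\<not> d)" for i
    using all[of i] by (auto simp: movable_def)
  have "vertex_type M N \<sigma>' i y' = vertex_type M N \<sigma> i y'"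
    if "y' mod int N \<noteq> y mod int N" "y' mod int N \<noteq> (y + 1) mod int N" for i y'
    using that by (auto simp: vertex_type_def \<sigma>'_def loop_hor loop_ver)
  then obtain R where R: "config_weight M N w \<sigma> = (\<Prod>i\<in>{0..<int M}. pair_weight w \<sigma> y i) * R"
    "config_weight M N w \<sigma>' = (\<Prod>i\<in>{0..<int M}. pair_weight w \<sigma>' y i) * R"
    by (rule config_weight_rows)
  have "pair_weight w \<sigma> y i = pair_weight w \<sigma>' y i" for i
    using weight_middle[of _ d] kirchhoff_rows[OF \<sigma>, of i y] mv
    unfolding pair_weight_def vertex_type_rows by (simp add: \<sigma>'_def loop_hor loop_ver)
  with R have "config_weight M N w \<sigma> = config_weight M N w \<sigma>'" by simp
  moreover have "rate d \<sigma> x y = rev_rate d \<sigma>' x y"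
    using kirchhoff_rows[OF \<sigma>, of x y] mv unfolding vertex_type_rows
    by (cases d; cases "\<sigma> (ver M N x y)"; cases "\<sigma> (ver M N x (y - 1))"; cases "\<sigma> (ver M N x (y + 1))")
       (simp_all add: \<sigma>'_def loop_hor loop_ver seed_rate_def rev_seed_rate_def)
  ultimately show ?thesis by simp
qed

section \<open>Matching jumps with reversed jumps\<close>

lemma arc_from_exists:
  assumes \<sigma>: "\<sigma> \<in> path_configs M N" and nz: "rate d \<sigma> x y \<noteq> 0"
    and some: "\<not> (\<forall>i. movable M N d \<sigma> y i)"
  obtains c where "arc_from d x y c \<sigma>"
proof -
  note r = nz[unfolded rate_neq_0[OF \<sigma>]]
  from some obtain i where i: "\<not> movable M N d \<sigma> y i" by blast
  define j where "j = nat ((i - x) mod int M)"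
  have j: "(x + int j) mod int M = i mod int M" "j < M"
    using M by (simp_all add: j_def mod_add_right_eq nat_less_iff)
  have "\<not> movable M N d \<sigma> y (x + int j)"
    using i movable_cong[OF j(1)] by simp
  then obtain c where "c + 1 < M" "\<And>j. j \<le> c \<Longrightarrow> movable M N d \<sigma> y (x + int j)"
    "\<not> movable M N d \<sigma> y (x + (int c + 1))"
    using exists_run[of "\<lambda>k. movable M N d \<sigma> y (x + k)" j M] r j(2) by auto
  then show thesis
    using r that[of c] by (simp add: arc_from_def add.assoc)
qed

lemma jump_arc_from:
  assumes "arc_from d x y c \<sigma>"
  shows "jump M N d x y \<sigma> = arc_jump M N d x y c \<sigma>"
  using assms by (intro jump_eq_arc) (auto simp: arc_from_def all_movable)

lemma arc_from_unique:
  assumes "arc_from d x y c \<sigma>" "arc_from d x y c' \<sigma>"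
  shows "c = c'"
  using assms by (intro run_unique[of _ "\<lambda>k. movable M N d \<sigma> y (x + k)"]) (auto simp: arc_from_def add.assoc)

lemma arc_from_cong:
  assumes "x mod int M = z mod int M"
  shows "arc_from d x y c \<sigma> = arc_from d z y c \<sigma>"
proof -
  have mv: "movable M N d' \<sigma> y (x + k) = movable M N d' \<sigma> y (z + k)" for d' k
    using assms by (intro movable_cong) (metis mod_add_left_eq)
  have "movable M N d' \<sigma> y (x + int c + 1) = movable M N d' \<sigma> y (z + int c + 1)" for d'
    using mv[of d' "int c + 1"] by (simp only: add.assoc)
  moreover have "movable M N d' \<sigma> y (x - 1) = movable M N d' \<sigma> y (z - 1)" for d'
    using mv[of d' "- 1"] by simp
  moreover have "ver M N x y = ver M N z y" using assms by simp
  ultimately show ?thesis unfolding arc_from_def by (simp only: mv)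
qed

lemma arc_jump_movable:
  assumes "arc_from d x y c \<sigma>" "\<sigma> \<in> path_configs M N"
  defines "\<sigma>' \<equiv> arc_jump M N d x y c \<sigma>"
  shows "\<And>j. j \<le> c \<Longrightarrow> movable M N (\<not> d) \<sigma>' y (x + int j)" "\<not> movable M N (\<not> d) \<sigma>' y (x - 1)"
    "\<sigma>' \<in> path_configs M N" "arc_jump M N (\<not> d) x y c \<sigma>' = \<sigma>" "same_heights M N \<sigma> \<sigma>'"
proof -
  note a = arc_fromD[OF assms(1,2)]
  note c = a(1)
  show "movable M N (\<not> d) \<sigma>' y (x + int j)" if "j \<le> c" for j
    using that c by (simp add: movable_def \<sigma>'_def arc_hor[OF c])
  \<comment> \<open>Column \<open>x - 1\<close> has offset \<open>M - 1\<close>, which exceeds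
    \<open>c\<close>; it lies outside the stretch and keeps its states.\<close>
  have "(x - 1 - x) mod int M = int M - 1"
    using offset_pred[of x x] by auto
  then show "\<not> movable M N (\<not> d) \<sigma>' y (x - 1)"
    using a(4) c by (simp add: movable_def \<sigma>'_def arc_hor[OF c])
  show "\<sigma>' \<in> path_configs M N"
    unfolding \<sigma>'_def by (rule arc_path_configs[OF assms(2) c a(2,5,6)])
  show "arc_jump M N (\<not> d) x y c \<sigma>' = \<sigma>"
    unfolding \<sigma>'_def by (rule arc_jump_inverse[OF c a(2,5,6)])
  show "same_heights M N \<sigma> \<sigma>'"
    unfolding \<sigma>'_def by (rule arc_same_heights[OF c a(2,5,6)])
qed

lemma loop_jump_movable: "movable M N (\<not> d) (loop_jump M N d y \<sigma>) y i"
  by (simp add: movable_def loop_hor)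

text \<open>The preceding configuration is recovered by running left from \<open>e\<close> as far as
  \<open>\<sigma>'\<close> allows and applying the opposite jump to that stretch. The conditions
  contained in a nonzero reversed rate at \<open>e\<close> ensure that the forward run from there
  ends at \<open>e\<close>.\<close>

lemma arc_into_exists:
  assumes \<sigma>': "\<sigma>' \<in> path_configs M N" and nz: "rev_rate d \<sigma>' e y \<noteq> 0"
    and some: "\<not> (\<forall>i. movable M N (\<not> d) \<sigma>' y i)"
  obtains x c \<sigma> where "x \<in> {0..<int M}" "\<sigma> \<in> path_configs M N" "arc_from d x y c \<sigma>"
    "\<sigma>' = arc_jump M N d x y c \<sigma>" "e mod int M = (x + int c + 1) mod int M"
proof -
  note r = nz[unfolded rev_rate_neq_0[OF \<sigma>']]
  from some obtain i where i: "\<not> movable M N (\<not> d) \<sigma>' y i" by blast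
  define j where "j = nat ((e - 1 - i) mod int M)"
  have j: "(e - 1 - int j) mod int M = i mod int M" "j < M"
    using M mod_diff_right_eq[of "e - 1" "e - 1 - i" "int M"] by (simp_all add: j_def nat_less_iff)
  have "\<not> movable M N (\<not> d) \<sigma>' y (e - 1 - int j)"
    using i movable_cong[OF j(1)] by simp
  then obtain c where c: "c + 1 < M"
    and run: "\<And>j. j \<le> c \<Longrightarrow> movable M N (\<not> d) \<sigma>' y (e - 1 - int j)"
    and stop: "\<not> movable M N (\<not> d) \<sigma>' y (e - 1 - (int c + 1))"
    using exists_run[of "\<lambda>k. movable M N (\<not> d) \<sigma>' y (e - 1 - k)" j M] r j(2) by auto
  \<comment> \<open>\<open>z\<close> is the left end of the run, and \<open>x\<close> its
    representative in the summation range.\<close>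
  define z where "z = e - 1 - int c"
  define x where "x = z mod int M"
  have e: "e = z + int c + 1" by (simp add: z_def)
  have run': "movable M N (\<not> d) \<sigma>' y (z + int j)" if "j \<le> c" for j
    using run[of "c - j"] that by (simp add: z_def of_nat_diff algebra_simps)
  have stop': "\<not> movable M N (\<not> d) \<sigma>' y (z - 1)"
    using stop by (simp add: z_def algebra_simps)
  \<comment> \<open>The double negation matches the lemmas on arcs, which are applied in direction
    \<open>\<not> d\<close>.\<close>
  have first: "\<sigma>' (ver M N z y) = (\<not> (\<not> d))"
    using arc_first_ver[OF \<sigma>' _ stop'] run'[of 0] by simp
  have last: "\<sigma>' (ver M N (z + int c + 1) y) = (\<not> d)" using r by (simp add: e)
  define \<sigma> where "\<sigma> = arc_jump M N (\<not> d) z y c \<sigma>'"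
  have "\<sigma> \<in> path_configs M N"
    unfolding \<sigma>_def by (rule arc_path_configs[OF \<sigma>' c run' first last])
  moreover have inv: "arc_jump M N d z y c \<sigma> = \<sigma>'"
    using arc_jump_inverse[OF c run' first last] by (simp add: \<sigma>_def)
  have from_z: "arc_from d z y c \<sigma>"
    unfolding arc_from_def
  proof (intro conjI allI impI)
    show "c + 1 < M" by fact
    show "movable M N d \<sigma> y (z + int j)" if "j \<le> c" for j
      using that c by (simp add: movable_def \<sigma>_def arc_hor[OF c])
    show "\<not> movable M N d \<sigma> y (z + int c + 1)"
      using r c unfolding e by (simp add: movable_def \<sigma>_def arc_hor[OF c])
    have "(z - 1 - z) mod int M = int M - 1"
      using offset_pred[of z z] by auto
    then show "\<not> movable M N (\<not> d) \<sigma> y (z - 1)"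
      using stop' c by (simp add: movable_def \<sigma>_def arc_hor[OF c])
    show "\<sigma> (ver M N z y) = (\<not> d)"
      by (simp add: \<sigma>_def arc_ver[OF c])
  qed
  have x: "(x + k) mod int M = (z + k) mod int M" for k
    by (simp add: x_def mod_add_left_eq)
  have "arc_from d x y c \<sigma>"
    using from_z x[of 0] arc_from_cong[of x z] by simp
  moreover have "\<sigma>' = arc_jump M N d x y c \<sigma>"
    using inv arc_column_cong[of x z d y c \<sigma>] by (simp add: x_def)
  moreover have "e mod int M = (x + int c + 1) mod int M"
    using x[of "int c + 1"] by (simp add: e add.assoc)
  moreover have "x \<in> {0..<int M}" by (simp add: x_def)
  ultimately show thesis using that by blast
qed

text \<open>The length of the run to the left of \<open>e\<close> is visible in
  \<open>\<sigma>'\<close> alone. It fixes \<open>c\<close>, hence the starting column, and then the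
  preceding configuration because arc jumps can be undone.\<close>

lemma arc_into_unique:
  assumes "arc_from d x y c \<sigma>" "\<sigma> \<in> path_configs M N" "\<sigma>' = arc_jump M N d x y c \<sigma>"
    "e mod int M = (x + int c + 1) mod int M" "x \<in> {0..<int M}"
    and "arc_from d x' y c' \<rho>" "\<rho> \<in> path_configs M N" "\<sigma>' = arc_jump M N d x' y c' \<rho>"
    "e mod int M = (x' + int c' + 1) mod int M" "x' \<in> {0..<int M}"
  shows "x = x' \<and> \<sigma> = \<rho>"
proof -
  have shift: "(e - k) mod int M = (z + int b + 1 - k) mod int M"
    if "e mod int M = (z + int b + 1) mod int M" for z b k
    using that by (metis mod_diff_left_eq)
  have run: "movable M N (\<not> d) \<sigma>' y (e - 1 - int j)"
    if "j \<le> b" "arc_from d z y b s" "s \<in> path_configs M N" "\<sigma>' = arc_jump M N d z y b s"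
      "e mod int M = (z + int b + 1) mod int M" for j b s z
  proof -
    have "movable M N (\<not> d) \<sigma>' y (z + int (b - j))"
      using arc_jump_movable(1)[OF that(2,3), of "b - j"] that(4) by simp
    moreover have "(e - 1 - int j) mod int M = (z + int (b - j)) mod int M"
      using shift[OF that(5), of "1 + int j"] that(1) by (simp add: of_nat_diff algebra_simps)
    ultimately show ?thesis using movable_cong by blast
  qed
  have stop: "\<not> movable M N (\<not> d) \<sigma>' y (e - 1 - (int b + 1))"
    if "arc_from d z y b s" "s \<in> path_configs M N" "\<sigma>' = arc_jump M N d z y b s"
      "e mod int M = (z + int b + 1) mod int M" for b s z
  proof -
    have "\<not> movable M N (\<not> d) \<sigma>' y (z - 1)"
      using arc_jump_movable(2)[OF that(1,2)] that(3) by simp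
    moreover have "(e - 1 - (int b + 1)) mod int M = (z - 1) mod int M"
      using shift[OF that(4), of "2 + int b"] by (simp add: algebra_simps)
    ultimately show ?thesis using movable_cong by blast
  qed
  have c: "c = c'"
    by (rule run_unique[of c "\<lambda>k. movable M N (\<not> d) \<sigma>' y (e - 1 - k)" c'])
       (use run stop assms in blast)+
  have "(e - (int c + 1)) mod int M = x mod int M" "(e - (int c + 1)) mod int M = x' mod int M"
    using shift[OF assms(4), of "int c + 1"] shift[OF assms(9), of "int c + 1"] c by simp_all
  then have "x = x'" using assms(5,10) by simp
  then show ?thesis
    using arc_jump_movable(4)[OF assms(1,2)] arc_jump_movable(4)[OF assms(6,7)] assms(3,8) c by simp
qed

text \<open>The flow into \<open>\<sigma>'\<close> through a fixed row and direction is rewritten as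
  a flow out of \<open>\<sigma>'\<close> for the reversed process. The factor
  \<open>\<kappa>\<close> carries the restriction to a sector and passes through because jumps keep
  the heights.\<close>

lemma sum_rates_into:
  assumes \<sigma>': "\<sigma>' \<in> path_configs M N"
    and inv: "\<And>\<sigma> \<rho>. \<sigma> \<in> path_configs M N \<Longrightarrow> \<rho> \<in> path_configs M N \<Longrightarrow> same_heights M N \<sigma> \<rho> \<Longrightarrow> \<kappa> \<rho> = \<kappa> \<sigma>"
  shows "(\<Sum>\<sigma>\<in>path_configs M N. \<Sum>x\<in>{0..<int M}. if jump M N d x y \<sigma> = \<sigma>'
            then \<kappa> \<sigma> * config_weight M N w \<sigma> * rate d \<sigma> x y else 0)
       = (\<Sum>e\<in>{0..<int M}. \<kappa> \<sigma>' * config_weight M N w \<sigma>' * rev_rate d \<sigma>' e y)"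
proof -
  let ?S = "path_configs M N" and ?I = "{0..<int M}"
  \<comment> \<open>A loop is matched with the reversed loop started in the same column, an arc with
    the reversed arc started at its right end.\<close>
  define R where "R = (\<lambda>(\<sigma>, x) e.
      x = e \<and> (\<forall>i. movable M N d \<sigma> y i) \<and> \<sigma>' = loop_jump M N d y \<sigma> \<or>
      (\<exists>c. arc_from d x y c \<sigma> \<and> \<sigma>' = arc_jump M N d x y c \<sigma> \<and> e mod int M = (x + int c + 1) mod int M))"
  define f where "f = (\<lambda>(\<sigma>, x). if jump M N d x y \<sigma> = \<sigma>'
      then \<kappa> \<sigma> * config_weight M N w \<sigma> * rate d \<sigma> x y else 0)"
  define g where "g e = \<kappa> \<sigma>' * config_weight M N w \<sigma>' * rev_rate d \<sigma>' e y" for e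
  have "sum f (?S \<times> ?I) = sum g ?I"
  proof (rule sum_eq_via_relation[where R = R])
    show "finite (?S \<times> ?I)" "finite ?I" using finite_path_configs by auto
  next
    fix a assume a: "a \<in> ?S \<times> ?I" "f a \<noteq> 0"
    obtain \<sigma> x where ax: "a = (\<sigma>, x)" by (cases a)
    have \<sigma>: "\<sigma> \<in> ?S" and x: "x \<in> ?I" and j: "jump M N d x y \<sigma> = \<sigma>'" and nz: "rate d \<sigma> x y \<noteq> 0"
      using a by (auto simp: ax f_def split: if_splits)
    show "\<exists>!b. b \<in> ?I \<and> R a b"
    proof (cases "\<forall>i. movable M N d \<sigma> y i")
      case True
      then have "\<sigma>' = loop_jump M N d y \<sigma>"
        using j jump_eq_loop[of M N d \<sigma> y x] by simp
      moreover have "\<not> arc_from d x y c \<sigma>" for c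
        using True by (auto simp: arc_from_def)
      ultimately show ?thesis
        using True x by (intro ex1I[of _ x]) (auto simp: R_def ax)
    next
      case False
      then obtain c where c: "arc_from d x y c \<sigma>"
        using arc_from_exists[OF \<sigma> nz] by blast
      have "\<sigma>' = arc_jump M N d x y c \<sigma>"
        using j jump_arc_from[OF c] by simp
      show ?thesis
      proof (intro ex1I[of _ "(x + int c + 1) mod int M"])
        show "(x + int c + 1) mod int M \<in> ?I \<and> R a ((x + int c + 1) mod int M)"
          using c \<open>\<sigma>' = arc_jump M N d x y c \<sigma>\<close> unfolding R_def ax by auto
        fix b assume b: "b \<in> ?I \<and> R a b"
        then obtain c' where "arc_from d x y c' \<sigma>" "b mod int M = (x + int c' + 1) mod int M"
          using False unfolding R_def ax by auto
        then show "b = (x + int c + 1) mod int M"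
          using arc_from_unique[OF c, of c'] b by simp
      qed
    qed
  next
    fix e assume e: "e \<in> ?I" "g e \<noteq> 0"
    have nz: "rev_rate d \<sigma>' e y \<noteq> 0" using e by (auto simp: g_def)
    show "\<exists>!a. a \<in> ?S \<times> ?I \<and> R a e"
    proof (cases "\<forall>i. movable M N (\<not> d) \<sigma>' y i")
      case True
      define \<sigma> where "\<sigma> = loop_jump M N (\<not> d) y \<sigma>'"
      have \<sigma>: "\<sigma> \<in> ?S"
        unfolding \<sigma>_def using loop_path_configs[OF \<sigma>'] True by blast
      have "loop_jump M N d y \<sigma> = \<sigma>'"
        using loop_jump_inverse[of "\<not> d" \<sigma>' y] True by (simp add: \<sigma>_def)
      moreover have "movable M N d \<sigma> y i" for i
        using loop_jump_movable[of "\<not> d" y \<sigma>' i] by (simp add: \<sigma>_def)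
      ultimately have member: "(\<sigma>, e) \<in> ?S \<times> ?I \<and> R (\<sigma>, e) e"
        using e(1) \<sigma> by (auto simp: R_def)
      have loop: "\<rho> = \<sigma>" if "\<forall>i. movable M N d \<rho> y i" "\<sigma>' = loop_jump M N d y \<rho>" for \<rho>
        using loop_jump_inverse[of d \<rho> y] that by (simp add: \<sigma>_def)
      \<comment> \<open>An arc leaves column \<open>x - 1\<close> not movable in direction
        \<open>\<not> d\<close>, so it cannot produce a row that is movable everywhere in that
        direction.\<close>
      have arc: False if "arc_from d x y c \<rho>" "\<rho> \<in> ?S" "\<sigma>' = arc_jump M N d x y c \<rho>" for \<rho> x c
        using arc_jump_movable(2)[OF that(1,2)] True that(3) by simp
      have "a = (\<sigma>, e)" if a: "a \<in> ?S \<times> ?I \<and> R a e" for a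
      proof -
        obtain \<rho> x where ax: "a = (\<rho>, x)" by (cases a)
        show ?thesis using a loop[of \<rho>] arc[of x _ \<rho>] unfolding R_def ax by blast
      qed
      with member show ?thesis by (rule ex1I)
    next
      case False
      obtain x c \<sigma> where *: "x \<in> {0..<int M}" "\<sigma> \<in> path_configs M N" "arc_from d x y c \<sigma>"
        "\<sigma>' = arc_jump M N d x y c \<sigma>" "e mod int M = (x + int c + 1) mod int M"
        by (rule arc_into_exists[OF \<sigma>' nz False])
      show ?thesis
      proof (intro ex1I[of _ "(\<sigma>, x)"])
        show "(\<sigma>, x) \<in> ?S \<times> ?I \<and> R (\<sigma>, x) e" using * by (auto simp: R_def)
        fix a assume a: "a \<in> ?S \<times> ?I \<and> R a e"
        obtain \<rho> x' where ax: "a = (\<rho>, x')" by (cases a)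
        have "\<not> ((\<forall>i. movable M N d \<rho> y i) \<and> \<sigma>' = loop_jump M N d y \<rho>)"
          using loop_jump_movable[of d y \<rho>] False by blast
        with a obtain c' where "arc_from d x' y c' \<rho>" "\<sigma>' = arc_jump M N d x' y c' \<rho>"
          "e mod int M = (x' + int c' + 1) mod int M" "\<rho> \<in> ?S" "x' \<in> ?I"
          by (auto simp: R_def ax)
        then show "a = (\<sigma>, x)"
          using arc_into_unique[OF *(3,2,4,5,1)] ax by blast
      qed
    qed
  next
    fix a e assume a: "a \<in> ?S \<times> ?I" "e \<in> ?I" "R a e"
    obtain \<sigma> x where ax: "a = (\<sigma>, x)" by (cases a)
    have \<sigma>: "\<sigma> \<in> ?S" using a ax by simp
    from a(3) consider
        (loop) "x = e" "\<forall>i. movable M N d \<sigma> y i" "\<sigma>' = loop_jump M N d y \<sigma>"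
      | (arc) c where "arc_from d x y c \<sigma>" "\<sigma>' = arc_jump M N d x y c \<sigma>"
          "e mod int M = (x + int c + 1) mod int M"
      unfolding R_def ax by auto
    then show "f a = g e"
    proof cases
      case loop
      have "jump M N d x y \<sigma> = \<sigma>'" using loop jump_eq_loop[of M N d \<sigma> y x] by simp
      moreover have "\<kappa> \<sigma>' = \<kappa> \<sigma>"
        using inv[OF \<sigma> \<sigma>'] loop_same_heights loop by blast
      ultimately show ?thesis
        using loop_weight[OF \<sigma>, of d y x] loop by (simp add: f_def g_def ax mult.assoc)
    next
      case arc
      have "jump M N d x y \<sigma> = \<sigma>'" using arc jump_arc_from by simp
      moreover have "\<kappa> \<sigma>' = \<kappa> \<sigma>"
        using inv[OF \<sigma> \<sigma>'] arc_jump_movable(5)[OF arc(1) \<sigma>] arc(2) by blast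
      moreover have "rev_rate d \<sigma>' e y = rev_rate d \<sigma>' (x + int c + 1) y"
        using vertex_type_cong[OF arc(3)] by simp
      ultimately show ?thesis
        using arc_from_weight[OF \<sigma> arc(1)] arc(2) by (simp add: f_def g_def ax mult.assoc)
    qed
  qed
  then show ?thesis by (simp add: f_def g_def sum.cartesian_product case_prod_unfold)
qed

section \<open>Global balance\<close>

lemma jump_path_configs:
  assumes \<sigma>: "\<sigma> \<in> path_configs M N" and nz: "rate d \<sigma> x y \<noteq> 0"
  shows "jump M N d x y \<sigma> \<in> path_configs M N"
proof (cases "\<forall>i. movable M N d \<sigma> y i")
  case True
  then show ?thesis using jump_eq_loop[of M N d \<sigma> y x] loop_path_configs[OF \<sigma>] by simp
next
  case False
  then obtain c where "arc_from d x y c \<sigma>"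
    using arc_from_exists[OF \<sigma> nz] by blast
  then show ?thesis using jump_arc_from arc_jump_movable(3)[OF _ \<sigma>] by simp
qed

text \<open>Periodicity removes both kinds of differences: vertex types are shifted by one row,
  pairs of horizontal edges by one column. The equality holds in every path configuration and for
  arbitrary values of the three rates, since \<open>rate_difference_local\<close> needs no relation
  between them.\<close>

lemma sum_rev_rate:
  assumes \<sigma>: "\<sigma> \<in> path_configs M N"
  shows "(\<Sum>x\<in>{0..<int M}. \<Sum>y\<in>{0..<int N}. \<Sum>d\<in>UNIV. rev_rate d \<sigma> x y)
       = (\<Sum>x\<in>{0..<int M}. \<Sum>y\<in>{0..<int N}. \<Sum>d\<in>UNIV. rate d \<sigma> x y)"
proof -
  define \<alpha> \<beta> :: "vtype \<Rightarrow> real" where "\<alpha> t = of_bool (t = (0,0,0,0) \<or> t = (1,1,1,1))"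
    and "\<beta> t = of_bool (t = (1,0,1,0) \<or> t = (0,1,0,1))" for t
  \<comment> \<open>Indexed by the column to the right of the pair of edges, so that the left and
    right differences at \<open>x\<close> are the values at \<open>x\<close> and
    \<open>x + 1\<close>.\<close>
  define \<delta> :: "int \<Rightarrow> int \<Rightarrow> real" where
    "\<delta> x y = of_bool (\<sigma> (hor M N (x - 1) y) \<noteq> \<sigma> (hor M N (x - 1) (y + 1)))" for x y
  let ?t = "vertex_type M N \<sigma>"
  let ?I = "{0..<int M}" and ?J = "{0..<int N}"
  have local: "(\<Sum>d\<in>UNIV. rev_rate d \<sigma> x y - rate d \<sigma> x y) =
      ((A + C - B) * (\<alpha> (?t x y) - \<alpha> (?t x (y + 1))) + (B + C - A) * (\<beta> (?t x (y + 1)) - \<beta> (?t x y))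
       + (A + B - C) * (\<delta> x y - \<delta> (x + 1) y)) / 2" for x y
  proof -
    have \<delta>': "\<delta> (x + 1) y = of_bool (\<sigma> (hor M N x y) \<noteq> \<sigma> (hor M N x (y + 1)))"
      by (simp add: \<delta>_def)
    show ?thesis
      using rate_difference_local[OF kirchhoff_rows[OF \<sigma>, of x y], of C A B]
      by (simp only: vertex_type_rows[of \<sigma> x y] \<alpha>_def \<beta>_def \<delta>' \<delta>_def[of x y])
  qed
  have col: "(\<Sum>y\<in>?J. h (?t x (y + 1))) = (\<Sum>y\<in>?J. h (?t x y))" for h :: "vtype \<Rightarrow> real" and x
    using N by (intro sum_periodic_shift arg_cong[where f = h] vertex_type_cong) auto
  have row: "(\<Sum>x\<in>?I. \<delta> (x + 1) y) = (\<Sum>x\<in>?I. \<delta> x y)" for y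
  proof (rule sum_periodic_shift)
    show "M > 0" using M by simp
    fix i j :: int assume "i mod int M = j mod int M"
    then have "(i - 1) mod int M = (j - 1) mod int M" by (metis mod_diff_left_eq)
    then have "hor M N (i - 1) z = hor M N (j - 1) z" for z by simp
    then show "\<delta> i y = \<delta> j y" unfolding \<delta>_def by (simp only:)
  qed
  have "(\<Sum>x\<in>?I. \<Sum>y\<in>?J. \<alpha> (?t x y) - \<alpha> (?t x (y + 1))) = 0"
    "(\<Sum>x\<in>?I. \<Sum>y\<in>?J. \<beta> (?t x (y + 1)) - \<beta> (?t x y)) = 0"
    by (simp_all add: sum_subtractf col)
  moreover have "(\<Sum>x\<in>?I. \<Sum>y\<in>?J. \<delta> x y - \<delta> (x + 1) y) = 0"
    by (subst sum.swap) (simp add: sum_subtractf row)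
  moreover have "(\<Sum>x\<in>?I. \<Sum>y\<in>?J. \<Sum>d\<in>UNIV. rev_rate d \<sigma> x y - rate d \<sigma> x y) =
      ((A + C - B) * (\<Sum>x\<in>?I. \<Sum>y\<in>?J. \<alpha> (?t x y) - \<alpha> (?t x (y + 1)))
       + (B + C - A) * (\<Sum>x\<in>?I. \<Sum>y\<in>?J. \<beta> (?t x (y + 1)) - \<beta> (?t x y))
       + (A + B - C) * (\<Sum>x\<in>?I. \<Sum>y\<in>?J. \<delta> x y - \<delta> (x + 1) y)) / 2"
    unfolding local by (simp add: sum.distrib sum_distrib_left flip: sum_divide_distrib)
  ultimately have "(\<Sum>x\<in>?I. \<Sum>y\<in>?J. \<Sum>d\<in>UNIV. rev_rate d \<sigma> x y - rate d \<sigma> x y) = 0" by simp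
  then show ?thesis by (simp add: sum_subtractf)
qed

text \<open>Each seed pair of nonzero rate leads to exactly one target in the state space. A
  \<open>jump\<close> evaluated away from seed pairs may have a meaningless result, but its rate is
  zero.\<close>

lemma sum_jump_rate_out:
  assumes \<sigma>: "\<sigma> \<in> path_configs M N"
  shows "(\<Sum>u\<in>path_configs M N. jump_rate M N C A B \<sigma> u)
       = (\<Sum>x\<in>{0..<int M}. \<Sum>y\<in>{0..<int N}. \<Sum>d\<in>UNIV. rate d \<sigma> x y)"
proof -
  have "(\<Sum>u\<in>path_configs M N. jump_rate M N C A B \<sigma> u) =
      (\<Sum>x\<in>{0..<int M}. \<Sum>y\<in>{0..<int N}. \<Sum>d\<in>UNIV. \<Sum>u\<in>path_configs M N.
        if jump M N d x y \<sigma> = u then rate d \<sigma> x y else 0)"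
    unfolding jump_rate_def
    by (subst sum.swap, intro sum.cong refl, subst sum.swap, intro sum.cong refl, rule sum.swap)
  also have "\<dots> = (\<Sum>x\<in>{0..<int M}. \<Sum>y\<in>{0..<int N}. \<Sum>d\<in>UNIV. rate d \<sigma> x y)"
    using jump_path_configs[OF \<sigma>] finite_path_configs by (intro sum.cong refl) (auto simp: sum.delta')
  finally show ?thesis .
qed

text \<open>Inflow equals outflow of the reversed process by the matching of jumps, and
  \<open>sum_rev_rate\<close> replaces the latter by the outflow of the process itself.\<close>

lemma balance:
  assumes \<sigma>': "\<sigma>' \<in> path_configs M N"
    and inv: "\<And>\<sigma> \<rho>. \<sigma> \<in> path_configs M N \<Longrightarrow> \<rho> \<in> path_configs M N \<Longrightarrow> same_heights M N \<sigma> \<rho> \<Longrightarrow> \<kappa> \<rho> = \<kappa> \<sigma>"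
  shows "(\<Sum>\<sigma>\<in>path_configs M N. \<kappa> \<sigma> * config_weight M N w \<sigma> * jump_rate M N C A B \<sigma> \<sigma>')
       = \<kappa> \<sigma>' * config_weight M N w \<sigma>' * (\<Sum>u\<in>path_configs M N. jump_rate M N C A B \<sigma>' u)"
proof -
  let ?S = "path_configs M N" and ?I = "{0..<int M}" and ?J = "{0..<int N}"
  let ?p = "\<lambda>\<sigma>. \<kappa> \<sigma> * config_weight M N w \<sigma>"
  let ?F = "\<lambda>\<sigma> x y d. if jump M N d x y \<sigma> = \<sigma>' then ?p \<sigma> * rate d \<sigma> x y else 0"
  have "(\<Sum>\<sigma>\<in>?S. ?p \<sigma> * jump_rate M N C A B \<sigma> \<sigma>') = (\<Sum>\<sigma>\<in>?S. \<Sum>x\<in>?I. \<Sum>y\<in>?J. \<Sum>d\<in>UNIV. ?F \<sigma> x y d)"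
    unfolding jump_rate_def sum_distrib_left by (intro sum.cong refl) auto
  \<comment> \<open>Rows and directions are moved outside, because jumps are matched within one row
    and one direction.\<close>
  also have "\<dots> = (\<Sum>\<sigma>\<in>?S. \<Sum>y\<in>?J. \<Sum>d\<in>UNIV. \<Sum>x\<in>?I. ?F \<sigma> x y d)"
    by (subst sum.swap[of _ ?J ?I], intro sum.cong refl, rule sum.swap)
  also have "\<dots> = (\<Sum>y\<in>?J. \<Sum>d\<in>UNIV. \<Sum>\<sigma>\<in>?S. \<Sum>x\<in>?I. ?F \<sigma> x y d)"
    by (subst sum.swap, intro sum.cong refl, rule sum.swap)
  also have "\<dots> = (\<Sum>y\<in>?J. \<Sum>d\<in>UNIV. \<Sum>x\<in>?I. ?p \<sigma>' * rev_rate d \<sigma>' x y)"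
    by (intro sum.cong refl, rule sum_rates_into[where \<kappa> = \<kappa>, OF \<sigma>'], rule inv)
  also have "\<dots> = (\<Sum>y\<in>?J. \<Sum>x\<in>?I. \<Sum>d\<in>UNIV. ?p \<sigma>' * rev_rate d \<sigma>' x y)"
    by (intro sum.cong refl, rule sum.swap)
  also have "\<dots> = (\<Sum>x\<in>?I. \<Sum>y\<in>?J. \<Sum>d\<in>UNIV. ?p \<sigma>' * rev_rate d \<sigma>' x y)"
    by (rule sum.swap)
  also have "\<dots> = ?p \<sigma>' * (\<Sum>x\<in>?I. \<Sum>y\<in>?J. \<Sum>d\<in>UNIV. rev_rate d \<sigma>' x y)"
    by (simp add: sum_distrib_left)
  finally show ?thesis by (simp only: sum_rev_rate[OF \<sigma>'] sum_jump_rate_out[OF \<sigma>'])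
qed

end

theorem theorem8p9:
  fixes M N :: nat
    and a1 a2 b1 b2 c1 c2 \<eta> :: real
    and k1 k2 :: int
    and \<Omega> :: "'w measure"
    and L :: "real \<Rightarrow> 'w \<Rightarrow> config"
  assumes "M \<ge> 1" and "N \<ge> 2"
    and "a1 > 0" and "a2 > 0" and "b1 > 0" and "b2 > 0" and "c1 > 0" and "c2 > 0"
    and "\<eta> > 0"
    and "sector M N k1 k2 \<noteq> {}"
    and "markov_jump_process \<Omega> (path_configs M N)
           (jump_rate M N
              (\<eta> * (c1 * c2 / sqrt (b1 * b2 * a1 * a2)))
              (\<eta> * (sqrt (b1 * b2) / sqrt (a1 * a2)))
              (\<eta> * (sqrt (a1 * a2) / sqrt (b1 * b2)))) L"
    and "distr \<Omega> (count_space (path_configs M N)) (L 0) =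
           gibbs_measure M N (six_vertex_weight a1 a2 b1 b2 c1 c2) k1 k2"
  shows "\<forall>\<tau>\<ge>0. distr \<Omega> (count_space (path_configs M N)) (L \<tau>) =
           gibbs_measure M N (six_vertex_weight a1 a2 b1 b2 c1 c2) k1 k2"
proof (intro allI impI)
  fix \<tau> :: real assume \<tau>: "\<tau> \<ge> 0"
  define A B C where "A = \<eta> * (sqrt (b1 * b2) / sqrt (a1 * a2))"
    and "B = \<eta> * (sqrt (a1 * a2) / sqrt (b1 * b2))"
    and "C = \<eta> * (c1 * c2 / sqrt (b1 * b2 * a1 * a2))"
  \<comment> \<open>The value is forced by \<open>A * a1 = K True * b1\<close> and
    \<open>A * a2 = K False * b2\<close>; the given rates make the remaining equations consistent
    with it.\<close>
  define K where "K d = \<eta> * (if d then sqrt (a1 * b2) / sqrt (a2 * b1) else sqrt (a2 * b1) / sqrt (a1 * b2))"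
    for d
  have sq: "sqrt a1 * sqrt a1 = a1" "sqrt a2 * sqrt a2 = a2" "sqrt b1 * sqrt b1 = b1" "sqrt b2 * sqrt b2 = b2"
    and sqpos: "sqrt a1 > 0" "sqrt a2 > 0" "sqrt b1 > 0" "sqrt b2 > 0"
    using assms by simp_all
  interpret six_vertex_torus M N a1 a2 b1 b2 c1 c2 A B C K
  proof
    show "A > 0" "B > 0" "C > 0"
      using assms by (simp_all add: A_def B_def C_def)
    show "C * (b2 * a1) = K True * (c1 * c2)" "A * a1 = K True * b1" "B * b2 = K True * a2"
      "C * (b1 * a2) = K False * (c1 * c2)" "A * a2 = K False * b2" "B * b1 = K False * a1"
      using sqpos unfolding A_def B_def C_def K_def
      by (simp_all add: real_sqrt_mult field_simps sq)
  qed (use assms in auto)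
  define Z where "Z = (\<Sum>\<sigma>'\<in>sector M N k1 k2. config_weight M N w \<sigma>')"
  \<comment> \<open>The normalised indicator of the sector depends on the heights only, and it
    extends the density by zero to the whole state space, where balance has to be checked.\<close>
  define \<kappa> where "\<kappa> \<sigma> = of_bool (\<sigma> \<in> sector M N k1 k2) / Z" for \<sigma>
  let ?p = "\<lambda>\<sigma>. \<kappa> \<sigma> * config_weight M N w \<sigma>"
  have gibbs: "gibbs_measure M N w k1 k2 = point_measure (path_configs M N) (\<lambda>\<sigma>. ennreal (?p \<sigma>))"
    unfolding gibbs_measure_def
    by (rule arg_cong[where f = "point_measure (path_configs M N)"]) (auto simp: \<kappa>_def Z_def)
  have cw: "config_weight M N w \<sigma> \<ge> 0" for \<sigma>
    unfolding config_weight_def using assms by (intro prod_nonneg) (auto simp: six_vertex_weight_def)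
  have nonneg: "?p \<sigma> \<ge> 0" for \<sigma>
    using cw by (simp add: \<kappa>_def Z_def sum_nonneg)
  have "distr \<Omega> (count_space (path_configs M N)) (L \<tau>) =
      point_measure (path_configs M N) (\<lambda>\<sigma>. ennreal (?p \<sigma>))"
  proof (rule markov_jump_process_stationary)
    show "finite (path_configs M N)" by (rule finite_path_configs)
    show "markov_jump_process \<Omega> (path_configs M N) (jump_rate M N C A B) L"
      using assms unfolding A_def B_def C_def by simp
    show "distr \<Omega> (count_space (path_configs M N)) (L 0) =
        point_measure (path_configs M N) (\<lambda>\<sigma>. ennreal (?p \<sigma>))"
      using assms gibbs by simp
    show "?p \<sigma> \<ge> 0" for \<sigma> by (rule nonneg)
    show "\<tau> \<ge> 0" by (rule \<tau>)
    fix \<sigma>' assume \<sigma>': "\<sigma>' \<in> path_configs M N"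
    show "(\<Sum>\<sigma>\<in>path_configs M N. ?p \<sigma> * jump_rate M N C A B \<sigma> \<sigma>') =
        ?p \<sigma>' * (\<Sum>u\<in>path_configs M N. jump_rate M N C A B \<sigma>' u)"
      by (rule balance[OF \<sigma>']) (simp add: \<kappa>_def sector_same_heights)
  qed
  then show "distr \<Omega> (count_space (path_configs M N)) (L \<tau>) = gibbs_measure M N w k1 k2"
    by (simp add: gibbs)
qed

end
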